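(* Let $K$ be an algebraically closed field of characteristic zero, let $d\geq 5$ and $2\leq\ell\leq d-1$ be integers with $d\equiv 1\pmod{\ell}$, and let $C\subset\mathbb{P}^2(K)$ be a non-singular plane curve of degree $d$. Assume that $Aut(C)$ contains an element of order $\ell(d-1)$. Then $C$ is isomorphic to a curve of the form $$X^d+Y^{d-1}Z+\alpha XZ^{d-1}+\sum_{2\leq j=\ell k\leq d-2}\beta_{j0}X^{d-j}Z^{j}=0,$$ where $\alpha\in K$, $\alpha\neq 0$, the $\beta_{j0}$ are in $K$, and the sum runs over the multiples $j=\ell k$ of $\ell$ with $2\le j\le d-2$. Consequently, $Aut(C)$ is cyclic.
   Context: $Aut(C)$ is the full automorphism group of $C$ over $K$, identified with the finite subgroup of $PGL_3(K)$ preserving the defining equation of $C$. *)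

theory Defs
  imports
    "HOL-Analysis.Determinants"
    "HOL-Algebra.Elementary_Groups"
    "HOL-Algebra.Multiplicative_Group"
    "HOL-Computational_Algebra.Polynomial"
    "HOL-Library.Poly_Mapping"
    "HOL-Library.Numeral_Type"
    "HOL-Number_Theory.Cong"
begin

section \<open>Ternary polynomials\<close>

text \<open>
  Polynomials in three indeterminates are finitely supported maps from exponent vectors to
  coefficients; multiplication is the convolution product of \<^theory>\<open>HOL-Library.Poly_Mapping\<close>.
  In the index type \<open>3\<close> the numeral \<open>3\<close> denotes \<open>0\<close>, so \<open>1\<close>, \<open>2\<close>, \<open>3\<close> are
  its three distinct elements.
\<close>

type_synonym 'k tpoly = "(3 \<Rightarrow>\<^sub>0 nat) \<Rightarrow>\<^sub>0 'k"

definition tconst :: "'k::comm_ring_1 \<Rightarrow> 'k tpoly" where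
  "tconst c = Poly_Mapping.single 0 c"

definition tvar :: "3 \<Rightarrow> 'k::comm_ring_1 tpoly" where
  "tvar i = Poly_Mapping.single (Poly_Mapping.single i 1) 1"

definition teval :: "'k::comm_ring_1 tpoly \<Rightarrow> 'k ^ 3 \<Rightarrow> 'k" where
  "teval F v = (\<Sum>m\<in>Poly_Mapping.keys F. Poly_Mapping.lookup F m * (\<Prod>i\<in>UNIV. (v $ i) ^ Poly_Mapping.lookup m i))"

definition tsubst :: "(3 \<Rightarrow> 'k::comm_ring_1 tpoly) \<Rightarrow> 'k tpoly \<Rightarrow> 'k tpoly" where
  "tsubst \<sigma> F = (\<Sum>m\<in>Poly_Mapping.keys F. tconst (Poly_Mapping.lookup F m) * (\<Prod>i\<in>UNIV. \<sigma> i ^ Poly_Mapping.lookup m i))"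

definition partial_deriv :: "3 \<Rightarrow> 'k::comm_ring_1 tpoly \<Rightarrow> 'k tpoly" where
  "partial_deriv i F =
     (\<Sum>m\<in>Poly_Mapping.keys F. Poly_Mapping.single (m - Poly_Mapping.single i 1) (of_nat (Poly_Mapping.lookup m i) * Poly_Mapping.lookup F m))"

definition homogeneous :: "nat \<Rightarrow> 'k::comm_ring_1 tpoly \<Rightarrow> bool" where
  "homogeneous d F \<longleftrightarrow> (\<forall>m\<in>Poly_Mapping.keys F. (\<Sum>i\<in>UNIV. Poly_Mapping.lookup m i) = d)"


section \<open>Non-singular plane curves\<close>

text \<open>
  A plane curve is represented by a defining form, which is determined up to a nonzero scalar.
  Points of the projective plane are given by nonzero vectors of homogeneous coordinates.
\<close>

definition nonsingular_plane_curve :: "nat \<Rightarrow> 'k::field tpoly \<Rightarrow> bool" where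
  "nonsingular_plane_curve d F \<longleftrightarrow>
     F \<noteq> 0 \<and> homogeneous d F \<and>
     \<not> (\<exists>v. v \<noteq> 0 \<and> teval F v = 0 \<and> (\<forall>i. teval (partial_deriv i F) v = 0))"

text \<open>
  \<open>lin_subst A F\<close> is the form whose value at \<open>v\<close> is the value of \<open>F\<close> at \<open>A v\<close>. Hence
  \<open>v \<mapsto> A v\<close> maps the curve of \<open>lin_subst A F\<close> onto the curve of \<open>F\<close>.
\<close>

definition lin_subst :: "'k::comm_ring_1 ^ 3 ^ 3 \<Rightarrow> 'k tpoly \<Rightarrow> 'k tpoly" where
  "lin_subst A = tsubst (\<lambda>i. \<Sum>j\<in>UNIV. tconst (A $ i $ j) * tvar j)"

text \<open>
  Isomorphisms between non-singular plane curves of degree at least 4 are induced by projective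
  linear transformations, so isomorphism is understood in the same sense as the identification
  of the automorphism group with a subgroup of the projective linear group.
\<close>

definition isomorphic_curves :: "'k::field tpoly \<Rightarrow> 'k tpoly \<Rightarrow> bool" where
  "isomorphic_curves F G \<longleftrightarrow>
     (\<exists>A c. invertible A \<and> c \<noteq> 0 \<and> lin_subst A F = tconst c * G)"


section \<open>The projective linear group and the automorphism group of a curve\<close>

definition GL3 :: "('k::field ^ 3 ^ 3) monoid" where
  "GL3 = \<lparr>carrier = {A. invertible A}, monoid.mult = (**), one = mat 1\<rparr>"

definition scalars :: "('k::field ^ 3 ^ 3) set" where
  "scalars = {mat c | c. c \<noteq> 0}"

definition PGL3 :: "('k::field ^ 3 ^ 3) set monoid" where
  "PGL3 = GL3 Mod scalars"

definition Aut :: "'k::field tpoly \<Rightarrow> ('k ^ 3 ^ 3) set monoid" where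
  "Aut F = PGL3\<lparr>carrier :=
     {scalars #>\<^bsub>GL3\<^esub> A | A. invertible A \<and> (\<exists>c. c \<noteq> 0 \<and> lin_subst A F = tconst c * F)}\<rparr>"

end

theory Submission
  imports Defs
begin

text \<open>
  Diagonalize the given automorphism as \<open>diag(a)\<close> of order \<open>l(d-1)\<close>. All monomials of the form
  have the same weight, and non-singularity at the coordinate points provides monomials
  \<open>X_i^(d-1) X_\<phi>(i)\<close> for every \<open>i\<close>; the order of \<open>a\<close> only leaves the shape \<open>r \<mapsto> q \<mapsto> p \<mapsto> p\<close> for
  \<open>\<phi>\<close>, and then weights determine the remaining monomials.

  The normal form \<open>Y^(d-1) Z + g(X,Z)\<close> is invariant under the homologies \<open>diag(1,\<xi>,1)\<close> with
  \<open>\<xi>^(d-1) = 1\<close>. If an automorphism moved their centre \<open>(0:1:0)\<close>, conjugation would give a second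
  centre \<open>Q\<close> on the curve, and the binary form cut out on the line joining the two centres would
  have a symmetry that it does not admit for \<open>d \<ge> 5\<close>. So every automorphism fixes \<open>(0:1:0)\<close>;
  comparing coefficients, with the \<open>X^(d-1) Z\<close> term missing, makes it diagonal. Scaled to
  \<open>diag(1,\<eta>,\<omega>)\<close>, it satisfies \<open>\<eta>^(d-1) \<omega> = 1\<close>, so it is determined by the root of unity \<open>\<eta>\<close>.
\<close>

section \<open>Evaluation of ternary polynomials\<close>

lemma sum_single_lookup:
  fixes F :: "'a \<Rightarrow>\<^sub>0 'b::comm_monoid_add"
  shows "(\<Sum>m\<in>Poly_Mapping.keys F. Poly_Mapping.single m (Poly_Mapping.lookup F m)) = F"
  by (rule poly_mapping_eqI)
    (auto simp: lookup_sum lookup_single when_def in_keys_iff sum.delta cong: if_cong)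

lemma teval_superset:
  assumes "finite S" "Poly_Mapping.keys F \<subseteq> S"
  shows "teval F v = (\<Sum>m\<in>S. Poly_Mapping.lookup F m * (\<Prod>i\<in>UNIV. (v $ i) ^ Poly_Mapping.lookup m i))"
  unfolding teval_def using assms by (intro sum.mono_neutral_left) (auto simp: in_keys_iff)

lemma teval_0 [simp]: "teval 0 v = 0"
  by (simp add: teval_def)

lemma teval_add [simp]: "teval (F + G) v = teval F v + teval G v"
  by (subst (1 2 3) teval_superset[of "Poly_Mapping.keys F \<union> Poly_Mapping.keys G"])
    (auto simp: keys_add lookup_add algebra_simps sum.distrib)

lemma teval_single [simp]:
  "teval (Poly_Mapping.single m c) v = c * (\<Prod>i\<in>UNIV. (v $ i) ^ Poly_Mapping.lookup m i)"
  by (simp add: teval_superset[of "{m}"])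

lemma teval_sum [simp]: "teval (sum f A) v = (\<Sum>a\<in>A. teval (f a) v)"
  by (induction A rule: infinite_finite_induct) auto

lemma teval_mult [simp]: "teval (F * G) v = teval F v * teval G v"
proof -
  have *: "teval (Poly_Mapping.single m a * Poly_Mapping.single n b) v
      = teval (Poly_Mapping.single m a) v * teval (Poly_Mapping.single n b) v" for m n a b
    by (simp add: mult_single lookup_add power_add prod.distrib algebra_simps)
  have "teval (F * G) v =
    teval ((\<Sum>m\<in>Poly_Mapping.keys F. Poly_Mapping.single m (Poly_Mapping.lookup F m)) *
           (\<Sum>n\<in>Poly_Mapping.keys G. Poly_Mapping.single n (Poly_Mapping.lookup G n))) v"
    by (simp only: sum_single_lookup)
  also have "\<dots> =
    teval (\<Sum>m\<in>Poly_Mapping.keys F. Poly_Mapping.single m (Poly_Mapping.lookup F m)) v *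
    teval (\<Sum>n\<in>Poly_Mapping.keys G. Poly_Mapping.single n (Poly_Mapping.lookup G n)) v"
    unfolding sum_product teval_sum * ..
  finally show ?thesis
    by (simp only: sum_single_lookup)
qed

lemma teval_tconst [simp]: "teval (tconst c) v = c"
  by (simp add: tconst_def)

lemma teval_1 [simp]: "teval 1 v = 1"
  using teval_tconst[of 1 v] by (simp add: tconst_def)

lemma teval_power [simp]: "teval (F ^ n) v = teval F v ^ n"
  by (induction n) auto

lemma teval_prod [simp]: "teval (prod f A) v = (\<Prod>a\<in>A. teval (f a) v)"
  by (induction A rule: infinite_finite_induct) auto

lemma teval_tvar [simp]: "teval (tvar i) v = v $ i"
  by (simp add: tvar_def lookup_single when_def if_distrib[of "power _"] cong: if_cong)

lemma teval_lin_subst [simp]: "teval (lin_subst A F) v = teval F (A *v v)"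
  by (simp add: lin_subst_def tsubst_def matrix_vector_mult_def teval_def[of F])

text \<open>Kronecker's substitution: along \<open>(x, x^D, x^(D^2))\<close> with \<open>D\<close> large, distinct
  monomials restrict to distinct powers of \<open>x\<close>.\<close>

lemma teval_eq_0_iff:
  fixes F :: "'k::field_char_0 tpoly"
  shows "(\<forall>v. teval F v = 0) \<longleftrightarrow> F = 0"
proof
  assume zero: "\<forall>v. teval F v = 0"
  define K where "K = Poly_Mapping.keys F"
  define D where "D = Suc (\<Sum>m\<in>K. \<Sum>i\<in>UNIV. Poly_Mapping.lookup m i)"
  have bound: "Poly_Mapping.lookup m i < D" if "m \<in> K" for m i
  proof -
    have "Poly_Mapping.lookup m i \<le> (\<Sum>i\<in>UNIV. Poly_Mapping.lookup m i)"
      by (rule member_le_sum) auto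
    also have "\<dots> \<le> (\<Sum>m\<in>K. \<Sum>i\<in>UNIV. Poly_Mapping.lookup m i)"
      using that by (intro member_le_sum) (auto simp: K_def)
    finally show ?thesis by (simp add: D_def)
  qed
  \<comment> \<open>Every exponent is below D, so the three exponents are the base D digits of
    \<open>e m\<close> and can be read off from it.\<close>
  define e :: "(3 \<Rightarrow>\<^sub>0 nat) \<Rightarrow> nat"
    where "e m = Poly_Mapping.lookup m 1 + D * (Poly_Mapping.lookup m 2 + D * Poly_Mapping.lookup m 3)" for m
  have inj: "inj_on e K"
  proof (rule inj_onI)
    fix m n assume mn: "m \<in> K" "n \<in> K" "e m = e n"
    have "D > 0" by (simp add: D_def)
    have 1: "Poly_Mapping.lookup m 1 = Poly_Mapping.lookup n 1"
      using arg_cong[OF mn(3), of "\<lambda>k. k mod D"] bound mn by (simp add: e_def)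
    then have 2: "Poly_Mapping.lookup m 2 + D * Poly_Mapping.lookup m 3 =
        Poly_Mapping.lookup n 2 + D * Poly_Mapping.lookup n 3"
      using mn(3) \<open>D > 0\<close> by (simp add: e_def)
    have 3: "Poly_Mapping.lookup m 2 = Poly_Mapping.lookup n 2"
      using arg_cong[OF 2, of "\<lambda>k. k mod D"] bound mn by simp
    with 2 have "Poly_Mapping.lookup m 3 = Poly_Mapping.lookup n 3"
      using \<open>D > 0\<close> by simp
    with 1 3 have "Poly_Mapping.lookup m i = Poly_Mapping.lookup n i" for i
      using exhaust_3[of i] by auto
    then show "m = n" by (rule poly_mapping_eqI)
  qed
  define p where "p = (\<Sum>m\<in>K. monom (Poly_Mapping.lookup F m) (e m))"
  have "poly p x = 0" for x
  proof -
    define v :: "'k ^ 3" where "v = vector [x, x ^ D, x ^ (D * D)]"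
    have "(\<Prod>i\<in>UNIV. v $ i ^ Poly_Mapping.lookup m i) = x ^ e m" for m
      unfolding UNIV_3 v_def e_def
      by (simp only: distrib_left power_add power_mult power2_eq_square) (simp add: mult_ac)
    then have "poly p x = teval F v"
      by (simp add: p_def teval_def K_def poly_sum poly_monom)
    then show ?thesis using zero by simp
  qed
  then have "p = 0"
    using poly_all_0_iff_0 by blast
  have "Poly_Mapping.lookup F m = 0" if "m \<in> K" for m
  proof -
    have "coeff p (e m) = (\<Sum>n\<in>K. if n = m then Poly_Mapping.lookup F n else 0)"
      unfolding p_def coeff_sum coeff_monom
      using that inj by (intro sum.cong) (auto simp: inj_on_eq_iff)
    also have "\<dots> = Poly_Mapping.lookup F m"
      using that by (simp add: K_def)
    finally show ?thesis by (simp add: \<open>p = 0\<close>)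
  qed
  then show "F = 0"
    by (intro poly_mapping_eqI) (auto simp: K_def in_keys_iff)
qed auto

text \<open>Identities between forms can be checked on values, where \<open>lin_subst\<close> is
  just composition with a matrix; the substitution itself never has to be expanded.\<close>

lemma tpoly_eqI:
  fixes F G :: "'k::field_char_0 tpoly"
  assumes "\<And>v. teval F v = teval G v"
  shows "F = G"
proof -
  have "teval (F - G) v = 0" for v
    using assms[of v] teval_add[of "F - G" G v] by simp
  then show ?thesis
    using teval_eq_0_iff[of "F - G"] by simp
qed

section \<open>Roots of unity\<close>

lemma power_commute: "(x ^ i) ^ j = (x ^ j) ^ i" for x :: "'k::monoid_mult"
  by (metis mult.commute power_mult)

lemma power_power_eq_1:
  fixes x :: "'k::monoid_mult"
  assumes "x ^ n = 1"
  shows "(x ^ i) ^ n = 1"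
  using assms by (simp add: power_commute[of x i])

lemma power_gcd_eq_1:
  fixes x :: "'k::field"
  assumes "x ^ a = 1" "x ^ b = 1"
  shows "x ^ gcd a b = 1"
proof (cases "a = 0")
  case False
  obtain u v where "a * u = b * v + gcd a b"
    using bezout_nat[OF False] by blast
  then have "x ^ (a * u) = x ^ (b * v) * x ^ gcd a b"
    by (simp add: power_add)
  then show ?thesis
    using assms by (simp add: power_mult)
qed (use assms in simp)

text \<open>Induction on the prime factors: from a primitive n-th root \<zeta>, a p-th root y of
  \<zeta> has order p n as soon as y^n is not 1.\<close>

lemma ex_primitive_root_of_unity:
  assumes "n > 0"
  shows "\<exists>\<zeta>::'k::{alg_closed_field, field_char_0}. \<forall>k. \<zeta> ^ k = 1 \<longleftrightarrow> n dvd k"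
  using assms
proof (induction n rule: prime_divisors_induct)
  case (factor p n)
  then have p: "prime p" "n > 0" "p > 1"
    using prime_gt_1_nat[of p] by (auto intro: Nat.gr0I)
  obtain \<zeta> :: 'k where \<zeta>: "\<And>k. \<zeta> ^ k = 1 \<longleftrightarrow> n dvd k"
    using factor by auto
  \<comment> \<open>A nontrivial p-th root of unity: a root of 1 + T + ... + T^(p-1), whose value p
    at T = 1 is nonzero in characteristic zero.\<close>
  obtain \<xi> :: 'k where "(\<Sum>k\<le>p - 1. 1 * \<xi> ^ k) = 0"
    using alg_closed[of "p - 1" "\<lambda>_. 1::'k"] p by auto
  then have sum: "(\<Sum>k\<le>p - 1. \<xi> ^ k) = 0"
    by simp
  have \<xi>: "\<xi> ^ p = 1"
    using sum_gp_basic[of \<xi> "p - 1"] sum p by simp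
  have "\<xi> \<noteq> 1"
    using sum p by auto
  obtain x where x: "x ^ p = \<zeta>"
    using nth_root_exists[of p \<zeta>] p by auto
  \<comment> \<open>If x^n = 1, then p does not divide n, since otherwise \<zeta>^(n/p) = 1. Hence
    \<xi>^n is not 1, and x \<xi> serves instead of x.\<close>
  obtain y where y: "y ^ p = \<zeta>" "y ^ n \<noteq> 1"
  proof (cases "x ^ n = 1")
    case True
    have "\<not> p dvd n"
    proof
      assume "p dvd n"
      then obtain m where m: "n = p * m" by blast
      then have "\<zeta> ^ m = 1"
        using True x by (simp add: power_mult)
      then have "n dvd m" using \<zeta> by blast
      then show False using m p by (auto dest: dvd_imp_le)
    qed
    then have "gcd p n = 1"
      using p prime_imp_coprime coprime_iff_gcd_eq_1 by blast
    then have "\<xi> ^ n \<noteq> 1"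
      using power_gcd_eq_1[OF \<xi>, of n] \<open>\<xi> \<noteq> 1\<close> by auto
    then show ?thesis
      using that[of "x * \<xi>"] True x \<xi> by (simp add: power_mult_distrib)
  qed (use that x in blast)
  have "y ^ k = 1 \<longleftrightarrow> p * n dvd k" for k
  proof
    assume k: "y ^ k = 1"
    have "\<zeta> ^ k = 1"
      using k y(1) by (metis power_mult mult.commute power_one)
    then obtain j where j: "k = n * j"
      using \<zeta> by blast
    \<comment> \<open>As y^n differs from 1, its order is exactly the prime p, so p divides
      j.\<close>
    have "(y ^ n) ^ p = 1"
      using y(1) \<zeta>[of n] by (metis power_mult mult.commute dvd_refl)
    moreover have "(y ^ n) ^ j = 1"
      using k j by (simp add: power_mult)
    ultimately have "(y ^ n) ^ gcd p j = 1"
      by (rule power_gcd_eq_1)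
    then have "\<not> coprime p j"
      using y(2) by (auto simp: coprime_iff_gcd_eq_1)
    then have "p dvd j"
      using p prime_imp_coprime by blast
    then show "p * n dvd k"
      by (simp add: j mult_ac)
  next
    assume "p * n dvd k"
    then obtain j where "k = p * n * j" by (rule dvdE)
    then have "k = p * (n * j)" by (simp add: mult.assoc)
    then show "y ^ k = 1"
      using y(1) \<zeta>[of "n * j"] by (simp add: power_mult)
  qed
  then show ?case by blast
qed (auto intro!: exI[of _ 1])

text \<open>The n listed powers are distinct roots of T^n - 1, which has at most n roots.\<close>

lemma roots_of_unity_primitive_powers:
  fixes \<zeta> :: "'k::field"
  assumes n: "n > 0" and \<zeta>: "\<And>k. \<zeta> ^ k = 1 \<longleftrightarrow> n dvd k"
  shows "{x. x ^ n = 1} = (\<lambda>i. \<zeta> ^ i) ` {..<n}"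
proof -
  have nz: "\<zeta> \<noteq> 0"
    using \<zeta>[of n] n by (auto simp: zero_power)
  have "inj_on (\<lambda>i. \<zeta> ^ i) {..<n}"
  proof (rule linorder_inj_onI')
    fix i j assume ij: "i \<in> {..<n}" "j \<in> {..<n}" "i < j"
    then have "\<not> n dvd j - i"
      using n by (auto dest: dvd_imp_le)
    then show "\<zeta> ^ i \<noteq> \<zeta> ^ j"
      using \<zeta>[of "j - i"] nz ij by (auto simp: power_diff)
  qed
  then have card: "card ((\<lambda>i. \<zeta> ^ i) ` {..<n}) = n"
    by (simp add: card_image)
  define p :: "'k poly" where "p = monom 1 n - 1"
  have "coeff p n = 1"
    using n by (simp add: p_def)
  then have "p \<noteq> 0" by auto
  have roots: "{x. poly p x = 0} = {x. x ^ n = 1}"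
    by (auto simp: p_def poly_monom)
  have deg: "degree p \<le> n"
    unfolding p_def by (intro degree_diff_le) (auto simp: degree_monom_le)
  have "finite {x::'k. x ^ n = 1}" "card {x::'k. x ^ n = 1} \<le> n"
    using poly_roots_finite[OF \<open>p \<noteq> 0\<close>] card_poly_roots_bound[OF \<open>p \<noteq> 0\<close>] deg roots by auto
  moreover have "(\<lambda>i. \<zeta> ^ i) ` {..<n} \<subseteq> {x. x ^ n = 1}"
    using \<zeta>[of n] by (auto intro: power_power_eq_1)
  ultimately show ?thesis
    using card by (metis card_seteq)
qed

section \<open>Symmetries of a binary form\<close>

text \<open>For m > n both sides vanish, so coefficients can be compared without a bound on
  m.\<close>

lemma coeff_linear_power:
  fixes a b :: "'k::idom"
  shows "coeff ([:a, b:] ^ n) m = of_nat (n choose m) * b ^ m * a ^ (n - m)"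
proof (cases "m \<le> n")
  case False
  have "degree ([:a, b:] ^ n) \<le> 1 * n"
    by (rule order_trans[OF degree_power_le]) (auto intro: mult_right_mono)
  then show ?thesis
    using False by (simp add: coeff_eq_0 binomial_eq_0)
qed (simp add: coeff_linear_poly_power)

text \<open>Here \<open>a\<close>, \<open>b\<close>, \<open>c\<close> stand for the binomial coefficients of \<open>N\<close> over \<open>2\<close>, \<open>3\<close>, \<open>1\<close>.\<close>

lemma homology_coefficients:
  fixes a b c k \<xi> :: "'k::field_char_0"
  assumes "a * (1 + 2 * k) + c * k = a * \<xi>"
    and "b * (1 + 3 * k + 3 * k\<^sup>2) + a * k * (1 + 2 * k) = b * \<xi>\<^sup>2"
    and "2 * a = c * (c - 1)" "3 * b = a * (c - 2)" "a \<noteq> 0" "c \<noteq> 0"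
  shows "(\<xi>\<^sup>2 - 1) * ((c - 3) * (c + 1)) = 0"
proof -
  have "c * ((c - 1) * (1 + 2 * k) + 2 * k) = c * ((c - 1) * \<xi>)"
    using assms(1,3) by Groebner_Basis.algebra
  then have w: "(c - 1) * (1 + 2 * k) + 2 * k = (c - 1) * \<xi>"
    using assms(6) by (simp only: mult_cancel_left) simp
  have "a * ((c - 2) * (1 + 3 * k + 3 * k\<^sup>2) + 3 * k * (1 + 2 * k)) = a * ((c - 2) * \<xi>\<^sup>2)"
    using assms(2,4) by Groebner_Basis.algebra
  then have "(c - 2) * (1 + 3 * k + 3 * k\<^sup>2) + 3 * k * (1 + 2 * k) = (c - 2) * \<xi>\<^sup>2"
    using assms(5) by (simp only: mult_cancel_left) simp
  \<comment> \<open>The relation \<open>w\<close> says 2ck = (c-1)(\<xi>-1). Multiplying the other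
    relation by 4c and eliminating k leaves the factor \<xi>^2 - 1 times 3(c-1)^2 - 4c(c-2) =
    -(c-3)(c+1).\<close>
  then show ?thesis
    using w by Groebner_Basis.algebra
qed

text \<open>The binary form \<open>t ((s + q t)^N - (q t)^N)\<close> is the restriction of the curve to a line through
  the centre \<open>(0:1:0)\<close> of its homology. If the substitution \<open>t \<mapsto> \<kappa> s + \<xi> t\<close> preserves
  it, comparing the coefficients of \<open>s^2\<close> and \<open>s^3\<close> yields
  \<open>(\<xi>^2 - 1) (N - 3) (N + 1) = 0\<close>.\<close>

lemma no_second_homology:
  fixes q \<kappa> \<xi> :: "'k::field_char_0"
  assumes N: "N \<ge> 4" and \<xi>: "\<xi> ^ N = 1" "\<xi>\<^sup>2 \<noteq> 1"
    and inv: "\<And>s t. (\<kappa> * s + \<xi> * t) * ((s + (\<kappa> * s + \<xi> * t) * q) ^ N - ((\<kappa> * s + \<xi> * t) * q) ^ N)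
                = t * ((s + t * q) ^ N - (t * q) ^ N)"
  shows False
proof (cases "q = 0")
  case True
  have "\<xi> \<noteq> 1" using \<xi> by auto
  \<comment> \<open>For q = 0 the values at (1,0) and (1,1) give \<kappa> = 0 and then \<xi> =
    1.\<close>
  then show False
    using inv[of 1 0] inv[of 1 1] True N by (auto simp: zero_power)
next
  case False
  define k where "k = \<kappa> * q"
  \<comment> \<open>Dehomogenization: t = 1/q, followed by multiplication with q, leaves k =
    \<kappa> q as the only parameter besides \<xi>.\<close>
  have eq: "(k * s + \<xi>) * (((1 + k) * s + \<xi>) ^ N - (k * s + \<xi>) ^ N) = (s + 1) ^ N - 1" for s
  proof -
    have *: "(\<kappa> * s + \<xi> * (1 / q)) * q = k * s + \<xi>" "s + (k * s + \<xi>) = (1 + k) * s + \<xi>"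
      using False by (auto simp: k_def field_simps)
    have "q * ((\<kappa> * s + \<xi> * (1 / q)) * ((s + (\<kappa> * s + \<xi> * (1 / q)) * q) ^ N - ((\<kappa> * s + \<xi> * (1 / q)) * q) ^ N))
      = q * (1 / q * ((s + 1 / q * q) ^ N - (1 / q * q) ^ N))"
      using inv[of s "1 / q"] by simp
    also have "\<dots> = (s + 1) ^ N - 1"
      using False by simp
    also have "q * ((\<kappa> * s + \<xi> * (1 / q)) * ((s + (\<kappa> * s + \<xi> * (1 / q)) * q) ^ N - ((\<kappa> * s + \<xi> * (1 / q)) * q) ^ N))
      = ((\<kappa> * s + \<xi> * (1 / q)) * q) * ((s + (\<kappa> * s + \<xi> * (1 / q)) * q) ^ N - ((\<kappa> * s + \<xi> * (1 / q)) * q) ^ N)"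
      by (simp only: mult_ac)
    finally show ?thesis unfolding * .
  qed
  have "poly ([:\<xi>, k:] * ([:\<xi>, 1 + k:] ^ N - [:\<xi>, k:] ^ N)) s = poly ([:1, 1:] ^ N - 1) s" for s
    using eq[of s] by (simp add: algebra_simps)
  then have P: "[:\<xi>, k:] * ([:\<xi>, 1 + k:] ^ N - [:\<xi>, k:] ^ N) = [:1, 1:] ^ N - 1"
    by (intro poly_ext)
  have nz: "\<xi> \<noteq> 0" using \<xi> N by (auto simp: zero_power)
  have pw: "\<xi> ^ (N - m) * \<xi> ^ m = 1" if "m \<le> N" for m
    using that \<xi> by (simp flip: power_add)
  \<comment> \<open>The coefficient of s^(m+1), multiplied by \<xi>^m; since \<xi>^N = 1, no power
    of \<xi> survives on the left.\<close>
  have coeff_eq: "of_nat (N choose Suc m) * ((1 + k) ^ Suc m - k ^ Suc m)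
      + of_nat (N choose m) * k * ((1 + k) ^ m - k ^ m) = of_nat (N choose Suc m) * \<xi> ^ m"
    if "m > 0" "Suc m \<le> N" for m
  proof -
    have "\<xi> * (\<xi> ^ (N - Suc m) * (of_nat (N choose Suc m) * ((1 + k) ^ Suc m - k ^ Suc m)))
      + k * (\<xi> ^ (N - m) * (of_nat (N choose m) * ((1 + k) ^ m - k ^ m))) = of_nat (N choose Suc m)"
      using arg_cong[OF P, of "\<lambda>p. coeff p (Suc m)"] that
      by (simp add: coeff_linear_power algebra_simps del: power_Suc binomial_Suc_Suc)
    then have "\<xi> ^ m * (\<xi> * (\<xi> ^ (N - Suc m) * (of_nat (N choose Suc m) * ((1 + k) ^ Suc m - k ^ Suc m)))
      + k * (\<xi> ^ (N - m) * (of_nat (N choose m) * ((1 + k) ^ m - k ^ m)))) = \<xi> ^ m * of_nat (N choose Suc m)"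
      by (rule arg_cong)
    also have "\<xi> ^ m * (\<xi> * (\<xi> ^ (N - Suc m) * (of_nat (N choose Suc m) * ((1 + k) ^ Suc m - k ^ Suc m)))
      + k * (\<xi> ^ (N - m) * (of_nat (N choose m) * ((1 + k) ^ m - k ^ m)))) =
      (\<xi> ^ (N - Suc m) * \<xi> ^ Suc m) * (of_nat (N choose Suc m) * ((1 + k) ^ Suc m - k ^ Suc m))
      + (\<xi> ^ (N - m) * \<xi> ^ m) * (k * (of_nat (N choose m) * ((1 + k) ^ m - k ^ m)))"
      unfolding power_Suc[of \<xi>] distrib_left by (simp only: mult_ac)
    finally show ?thesis
      unfolding pw[OF that(2)] pw[OF Suc_leD[OF that(2)]] by (simp only: mult_1_left mult_ac)
  qed
  define c :: 'k where "c = of_nat N"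
  have c2: "2 * of_nat (N choose 2) = c * (c - 1)"
  proof -
    have "2 * (N choose 2) = N * (N - 1)"
      using binomial_absorption[of 1 N] by (simp add: numeral_2_eq_2)
    then have "of_nat (2 * (N choose 2)) = (of_nat (N * (N - 1)) :: 'k)" by (rule arg_cong)
    then show ?thesis using N by (simp add: c_def of_nat_diff)
  qed
  have c3: "3 * of_nat (N choose 3) = of_nat (N choose 2) * (c - 2)"
  proof -
    have "3 * (N choose 3) = (N choose 2) * (N - 2)"
      using binomial_absorb_comp[of N 2] binomial_absorption[of 2 N] by (simp add: numeral_3_eq_3 numeral_2_eq_2 mult.commute)
    then have "of_nat (3 * (N choose 3)) = (of_nat ((N choose 2) * (N - 2)) :: 'k)" by (rule arg_cong)
    then show ?thesis using N by (simp add: c_def of_nat_diff)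
  qed
  have "c \<noteq> 0" "c \<noteq> 1" "c \<noteq> 3" "c + 1 \<noteq> 0"
    using N of_nat_eq_iff[of N 0, where 'a='k] of_nat_eq_iff[of N 1, where 'a='k]
      of_nat_eq_iff[of N 3, where 'a='k] of_nat_eq_iff[of "N + 1" 0, where 'a='k]
    by (auto simp: c_def add.commute)
  have nz2: "of_nat (N choose 2) \<noteq> (0::'k)"
    using c2 \<open>c \<noteq> 0\<close> \<open>c \<noteq> 1\<close> by (metis mult_eq_0_iff right_minus_eq)
  define a b :: 'k where "a = of_nat (N choose 2)" and "b = of_nat (N choose 3)"
  have "a * (1 + 2 * k) + c * k = a * \<xi>"
    using coeff_eq[of 1] N
    by (simp add: a_def c_def power2_eq_square numeral_2_eq_2 algebra_simps del: binomial_Suc_Suc)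
  moreover have "b * (1 + 3 * k + 3 * k\<^sup>2) + a * k * (1 + 2 * k) = b * \<xi>\<^sup>2"
  proof -
    have "(1 + k) ^ 3 - k ^ 3 = 1 + 3 * k + 3 * k\<^sup>2" "(1 + k)\<^sup>2 - k\<^sup>2 = 1 + 2 * k"
      by Groebner_Basis.algebra+
    moreover have "Suc 2 = 3" by simp
    ultimately show ?thesis
      using coeff_eq[of 2] N by (simp add: a_def b_def)
  qed
  ultimately have "(\<xi>\<^sup>2 - 1) * ((c - 3) * (c + 1)) = 0"
    using homology_coefficients c2 c3 nz2 \<open>c \<noteq> 0\<close> unfolding a_def b_def by blast
  then show False
    using \<xi> \<open>c \<noteq> 3\<close> \<open>c + 1 \<noteq> 0\<close> by simp
qed

section \<open>Diagonalization\<close>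

definition diag_matrix :: "'k::zero ^ 'n \<Rightarrow> 'k ^ 'n ^ 'n" where
  "diag_matrix a = (\<chi> i j. if i = j then a $ i else 0)"

lemma diag_matrix_vector_mult [simp]:
  "diag_matrix a *v v = (\<chi> i. a $ i * v $ i)" for a :: "'k::comm_semiring_1 ^ 'n"
proof -
  have "(\<Sum>j\<in>UNIV. (if i = j then a $ i else 0) * v $ j) = (\<Sum>j\<in>UNIV. if i = j then a $ i * v $ j else 0)" for i
    by (intro sum.cong) auto
  then show ?thesis
    by (simp add: diag_matrix_def matrix_vector_mult_def)
qed

primrec matrix_power :: "'k::semiring_1 ^ 'n ^ 'n \<Rightarrow> nat \<Rightarrow> 'k ^ 'n ^ 'n" where
  "matrix_power A 0 = mat 1"
| "matrix_power A (Suc n) = matrix_power A n ** A"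

lemma matrix_power_commute: "A ** matrix_power A n = matrix_power A n ** A"
  by (induction n) (simp_all add: matrix_mul_assoc)

lemma matrix_power_Suc': "matrix_power A (Suc n) = A ** matrix_power A n"
  by (simp add: matrix_power_commute)

lemma mat_vector_mult [simp]: "mat c *v v = c *s v" for v :: "'k::comm_semiring_1 ^ 'n"
proof -
  have "(\<Sum>j\<in>UNIV. (if i = j then c else 0) * v $ j) = (\<Sum>j\<in>UNIV. if i = j then c * v $ j else 0)" for i
    by (intro sum.cong) auto
  then show ?thesis
    by (simp add: mat_def matrix_vector_mult_def vec_eq_iff)
qed

lemma invertible_mat_1: "invertible (mat 1 :: 'k::semiring_1 ^ 'n ^ 'n)"
  unfolding invertible_def by (rule exI[of _ "mat 1"]) simp

lemma invertible_matrix_power: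
  fixes A :: "'k::semiring_1 ^ 'n ^ 'n"
  assumes "invertible A"
  shows "invertible (matrix_power A n)"
  by (induction n) (simp_all add: invertible_mat_1 invertible_mult assms)

lemma invertible_matD:
  assumes "invertible (mat c :: 'k::field ^ 'n ^ 'n)"
  shows "c \<noteq> 0"
proof
  assume "c = 0"
  then have "mat c *v axis undefined 1 = (0 :: 'k ^ 'n)"
    by simp
  then show False
    using assms by (metis axis_eq_0_iff invertible_def matrix_left_invertible_ker zero_neq_one)
qed

text \<open>The vectors \<open>(1/n) (\<Sum>j<n. \<mu>^(-j) A^j v)\<close>, with \<open>\<mu>\<close> ranging over the
  \<open>n\<close>-th roots of \<open>s\<close>, are eigenvectors of \<open>A\<close> and sum up to \<open>v\<close>.\<close>

lemma span_eigenvectors: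
  fixes A :: "'k::{alg_closed_field, field_char_0} ^ 'n ^ 'n"
  assumes n: "n > 0" and A: "matrix_power A n = mat s" and s: "s \<noteq> 0"
  shows "vec.span {v. \<exists>\<mu>. A *v v = \<mu> *s v} = UNIV"
proof -
  obtain \<zeta> :: 'k where \<zeta>: "\<And>k. \<zeta> ^ k = 1 \<longleftrightarrow> n dvd k"
    using ex_primitive_root_of_unity[OF n] by blast
  obtain r where r: "r ^ n = s"
    using nth_root_exists[OF n] by blast
  have nz: "r \<noteq> 0" "\<zeta> \<noteq> 0"
    using r s n \<zeta>[of n] by (auto simp: zero_power)
  have "v \<in> vec.span {v. \<exists>\<mu>. A *v v = \<mu> *s v}" for v
  proof -
    define w where "w j = matrix_power A j *v v" for j
    have w0: "w 0 = v" by (simp add: w_def)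
    have wS: "A *v w j = w (Suc j)" for j
      by (simp only: w_def matrix_power_Suc' matrix_vector_mul_assoc)
    have wn: "w n = s *s v" by (simp add: w_def A)
    \<comment> \<open>Up to the factor n, this is the component of v in the eigenspace of \<zeta>^i
      r.\<close>
    define u where "u i = (\<Sum>j<n. inverse ((\<zeta> ^ i * r) ^ j) *s w j)" for i
    have eig: "A *v u i = (\<zeta> ^ i * r) *s u i" for i
    proof -
      define \<mu> where "\<mu> = \<zeta> ^ i * r"
      have \<mu>: "\<mu> \<noteq> 0" "\<mu> ^ n = s"
        using nz r \<zeta>[of n] by (auto simp: \<mu>_def power_mult_distrib power_power_eq_1)
      have "A *v u i = (\<Sum>j<n. inverse (\<mu> ^ j) *s w (Suc j))"
        by (simp add: u_def \<mu>_def vec.sum vec.scale wS)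
      also have "\<dots> = \<mu> *s (\<Sum>j<n. inverse (\<mu> ^ Suc j) *s w (Suc j))"
        using \<mu> by (simp add: vec.scale_sum_right flip: mult.assoc)
      \<comment> \<open>The index shift trades the term j = 0 for j = n; they agree because \<mu>^n
        = s and \<open>w n\<close> is s v.\<close>
      also have "(\<Sum>j<n. inverse (\<mu> ^ Suc j) *s w (Suc j)) = (\<Sum>j<n. inverse (\<mu> ^ j) *s w j) + inverse (\<mu> ^ n) *s w n - w 0"
        using sum.lessThan_Suc_shift[of "\<lambda>j. inverse (\<mu> ^ j) *s w j" n]
        unfolding sum.lessThan_Suc by (simp del: power_Suc)
      also have "\<dots> = u i"
        using s by (simp add: \<mu> wn w0 u_def flip: \<mu>_def)
      finally show ?thesis by (simp add: \<mu>_def)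
    qed
    \<comment> \<open>Summing over i first produces geometric sums of n-th roots of unity, of which
      only the one for j = 0 is nonzero.\<close>
    have "(\<Sum>i<n. u i) = (\<Sum>j<n. (\<Sum>i<n. inverse (\<zeta> ^ j) ^ i) *s (inverse (r ^ j) *s w j))"
    proof -
      have "(\<Sum>i<n. u i) = (\<Sum>j<n. \<Sum>i<n. inverse ((\<zeta> ^ i * r) ^ j) *s w j)"
        unfolding u_def by (rule sum.swap)
      also have "\<dots> = (\<Sum>j<n. \<Sum>i<n. (inverse (\<zeta> ^ j) ^ i) *s (inverse (r ^ j) *s w j))"
        by (intro sum.cong refl)
          (simp add: power_mult_distrib power_inverse power_commute[of \<zeta>])
      finally show ?thesis by (simp only: vec.scale_sum_left)
    qed
    also have "\<dots> = (\<Sum>j<n. if j = 0 then of_nat n *s v else 0)"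
    proof (intro sum.cong refl)
      fix j assume j: "j \<in> {..<n}"
      show "(\<Sum>i<n. inverse (\<zeta> ^ j) ^ i) *s (inverse (r ^ j) *s w j) = (if j = 0 then of_nat n *s v else 0)"
      proof (cases "j = 0")
        case False
        then have "\<zeta> ^ j \<noteq> 1"
          using \<zeta>[of j] j by (auto dest: dvd_imp_le)
        then have "inverse (\<zeta> ^ j) \<noteq> 1" by simp
        moreover have "inverse (\<zeta> ^ j) ^ n = 1"
          using \<zeta>[of n] by (simp add: power_inverse power_power_eq_1)
        ultimately have "(\<Sum>i<n. inverse (\<zeta> ^ j) ^ i) = 0"
          by (simp add: geometric_sum)
        then show ?thesis using False by simp
      qed (simp add: w0)
    qed
    also have "\<dots> = of_nat n *s v"
      using n by simp
    finally have sum_u: "v = inverse (of_nat n) *s (\<Sum>i<n. u i)"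
      using n by simp
    show ?thesis
      by (subst sum_u, intro vec.span_scale vec.span_sum vec.span_base) (use eig in auto)
  qed
  then show ?thesis by blast
qed

text \<open>Since the eigenvectors span the space, a basis can be chosen among them; it supplies the
  columns of P.\<close>

lemma diagonalizable_finite_order:
  fixes A :: "'k::{alg_closed_field, field_char_0} ^ 'n ^ 'n"
  assumes "n > 0" "matrix_power A n = mat s" "s \<noteq> 0"
  shows "\<exists>(P :: 'k ^ 'n ^ 'n) a. invertible P \<and> A ** P = P ** diag_matrix a"
proof -
  define E where "E = {v. \<exists>\<mu>. A *v v = \<mu> *s v}"
  obtain B where B: "B \<subseteq> E" "vec.independent B" "E \<subseteq> vec.span B"
    using vec.maximal_independent_subset[of E] by blast
  have span: "vec.span B = UNIV"
    using span_eigenvectors[OF assms] vec.span_mono[OF B(3)] by (auto simp: E_def vec.span_span)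
  have "card B = CARD('n)"
    using vec.dim_eq_card[of B UNIV] span B(2) vec_dim_card by (metis vec.span_UNIV)
  moreover have "finite B"
    using B(2) vec.finiteI_independent by blast
  ultimately obtain b where b: "bij_betw b (UNIV :: 'n set) B"
    using finite_same_card_bij[of "UNIV :: 'n set" B] by auto
  define P where "P = (\<chi> i j. b j $ i)"
  have col: "column j P = b j" for j
    by (simp add: P_def column_def vec_eq_iff)
  have "columns P = B"
    using b by (auto simp: columns_def col bij_betw_def)
  then have inv: "invertible P"
    using matrix_right_invertible_span_columns[of P] span invertible_right_inverse by metis
  have "b j \<in> E" for j
    using b B(1) by (auto simp: bij_betw_def)
  then have "\<exists>\<mu>. A *v b j = \<mu> *s b j" for j
    by (simp add: E_def)
  then obtain \<mu> where \<mu>: "A *v b j = \<mu> j *s b j" for j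
    by metis
  have "(A ** P) $ i $ j = (P ** diag_matrix (\<chi> j. \<mu> j)) $ i $ j" for i j
  proof -
    have "(A ** P) $ i $ j = (A *v b j) $ i"
      by (simp add: matrix_matrix_mult_def matrix_vector_mult_def P_def)
    also have "\<dots> = (\<Sum>k\<in>UNIV. if k = j then P $ i $ k * \<mu> k else 0)"
      by (simp add: \<mu> P_def mult.commute)
    also have "\<dots> = (P ** diag_matrix (\<chi> j. \<mu> j)) $ i $ j"
      by (simp add: matrix_matrix_mult_def diag_matrix_def if_distrib[of "(*) _"] cong: if_cong)
    finally show ?thesis .
  qed
  then have "A ** P = P ** diag_matrix (\<chi> j. \<mu> j)"
    by (simp add: vec_eq_iff)
  with inv show ?thesis
    by (intro exI[of _ P] exI[of _ "\<chi> j. \<mu> j"] conjI)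
qed

section \<open>Monomials of non-singular forms\<close>

text \<open>The restriction of F to the line through v with direction w. Its derivative at 0 is the
  directional derivative, which expresses singularity without reference to coordinates.\<close>

definition line_poly :: "'k::comm_ring_1 tpoly \<Rightarrow> 'k ^ 3 \<Rightarrow> 'k ^ 3 \<Rightarrow> 'k poly" where
  "line_poly F v w = (\<Sum>m\<in>Poly_Mapping.keys F.
     smult (Poly_Mapping.lookup F m) (\<Prod>i\<in>UNIV. [:v $ i, w $ i:] ^ Poly_Mapping.lookup m i))"

lemma poly_line_poly: "poly (line_poly F v w) t = teval F (v + t *s w)"
  by (simp add: line_poly_def teval_def poly_sum poly_prod)

lemma teval_partial_deriv:
  "teval (partial_deriv i F) v = (\<Sum>m\<in>Poly_Mapping.keys F. of_nat (Poly_Mapping.lookup m i) *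
     Poly_Mapping.lookup F m * (v $ i ^ (Poly_Mapping.lookup m i - 1) *
       (\<Prod>j\<in>UNIV - {i}. v $ j ^ Poly_Mapping.lookup m j)))"
proof -
  have "(\<Prod>j\<in>UNIV. v $ j ^ Poly_Mapping.lookup (m - Poly_Mapping.single i 1) j) =
      v $ i ^ (Poly_Mapping.lookup m i - 1) * (\<Prod>j\<in>UNIV - {i}. v $ j ^ Poly_Mapping.lookup m j)" for m
    by (subst prod.remove[of _ i]) (auto simp: lookup_minus lookup_single intro!: prod.cong)
  then show ?thesis
    by (simp add: partial_deriv_def)
qed

lemma pderiv_sum: "pderiv (sum f A) = (\<Sum>x\<in>A. pderiv (f x))"
  by (induction A rule: infinite_finite_induct) (auto simp: pderiv_add)

text \<open>The chain rule at parameter 0, obtained from the product rule on each monomial.\<close>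

lemma pderiv_line_poly:
  fixes F :: "'k::idom tpoly"
  shows "poly (pderiv (line_poly F v w)) 0 = (\<Sum>i\<in>UNIV. w $ i * teval (partial_deriv i F) v)"
proof -
  have pd: "pderiv ([:a, b:] ^ n) = smult (of_nat n * b) ([:a, b:] ^ (n - 1))" for a b :: 'k and n
    by (cases n) (simp_all add: pderiv_power_Suc pderiv_pCons mult.commute del: power_Suc of_nat_Suc)
  have "poly (pderiv (\<Prod>i\<in>UNIV. [:v $ i, w $ i:] ^ Poly_Mapping.lookup m i)) 0 =
     (\<Sum>i\<in>UNIV. w $ i * (of_nat (Poly_Mapping.lookup m i) * (v $ i ^ (Poly_Mapping.lookup m i - 1) *
       (\<Prod>j\<in>UNIV - {i}. v $ j ^ Poly_Mapping.lookup m j))))" for m :: "3 \<Rightarrow>\<^sub>0 nat"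
    by (simp add: pderiv_prod pd poly_sum poly_prod mult_ac)
  then show ?thesis
    by (simp add: line_poly_def teval_partial_deriv pderiv_sum pderiv_smult poly_sum
       sum_distrib_left sum.swap[of _ UNIV] mult_ac)
qed

text \<open>Directional derivatives are compatible with linear substitutions, unlike the partial ones.\<close>

lemma nonsingular_plane_curveD:
  fixes F :: "'k::field tpoly"
  assumes "nonsingular_plane_curve d F" "v \<noteq> 0" "teval F v = 0"
  shows "\<exists>w. poly (pderiv (line_poly F v w)) 0 \<noteq> 0"
proof -
  obtain i where "teval (partial_deriv i F) v \<noteq> 0"
    using assms unfolding nonsingular_plane_curve_def by blast
  then have "poly (pderiv (line_poly F v (axis i 1))) 0 \<noteq> 0"
    by (simp add: pderiv_line_poly axis_def if_distrib[of "\<lambda>x. x * _"] cong: if_cong)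
  then show ?thesis by blast
qed

lemma line_poly_lin_subst:
  fixes F :: "'k::field_char_0 tpoly"
  shows "line_poly (lin_subst A F) v w = line_poly F (A *v v) (A *v w)"
  by (rule poly_ext) (simp add: poly_line_poly matrix_vector_right_distrib vec.scale)

lemma homogeneous_teval:
  assumes "homogeneous d F"
  shows "teval F (t *s v) = t ^ d * teval F v"
proof -
  have "(\<Prod>i\<in>UNIV. (t *s v) $ i ^ Poly_Mapping.lookup m i) = t ^ d * (\<Prod>i\<in>UNIV. v $ i ^ Poly_Mapping.lookup m i)"
    if "m \<in> Poly_Mapping.keys F" for m
  proof -
    have "(\<Sum>i\<in>UNIV. Poly_Mapping.lookup m i) = d"
      using assms that by (simp add: homogeneous_def)
    then show ?thesis
      by (simp add: power_mult_distrib prod.distrib flip: power_sum)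
  qed
  then show ?thesis
    by (simp add: teval_def sum_distrib_left mult_ac)
qed

text \<open>A diagonal substitution multiplies each monomial by its weight. The form G, with
  coefficients scaled by weight minus c, vanishes everywhere, hence is zero.\<close>

lemma diagonal_semi_invariant:
  fixes F :: "'k::field_char_0 tpoly"
  assumes "\<And>v. teval F (\<chi> i. a $ i * v $ i) = c * teval F v" "m \<in> Poly_Mapping.keys F"
  shows "(\<Prod>i\<in>UNIV. a $ i ^ Poly_Mapping.lookup m i) = c"
proof -
  define G :: "'k tpoly" where "G = (\<Sum>m\<in>Poly_Mapping.keys F. Poly_Mapping.single m
    (Poly_Mapping.lookup F m * ((\<Prod>i\<in>UNIV. a $ i ^ Poly_Mapping.lookup m i) - c)))"
  have "teval G v = 0" for v
    using assms(1)[of v] unfolding G_def teval_sum teval_single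
    by (simp add: teval_def power_mult_distrib prod.distrib right_diff_distrib left_diff_distrib
      sum_subtractf sum_distrib_left mult_ac)
  then have "G = 0"
    using teval_eq_0_iff by blast
  moreover have "Poly_Mapping.lookup G m =
      Poly_Mapping.lookup F m * ((\<Prod>i\<in>UNIV. a $ i ^ Poly_Mapping.lookup m i) - c)"
    unfolding G_def lookup_sum lookup_single when_def
    using assms(2) by (subst sum.delta) auto
  ultimately show ?thesis
    using assms(2) by (simp add: in_keys_iff)
qed

text \<open>Homogeneity is detected by the scalar substitution 2: every monomial of the new form has
  weight 2^d, and in characteristic zero this determines its degree.\<close>

lemma homogeneous_lin_subst:
  fixes F :: "'k::field_char_0 tpoly"
  assumes "homogeneous d F"
  shows "homogeneous d (lin_subst A F)"
proof -
  have "(\<Sum>i\<in>UNIV. Poly_Mapping.lookup m i) = d" if "m \<in> Poly_Mapping.keys (lin_subst A F)" for m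
  proof -
    have "(\<chi> i. ((\<chi> i. 2) :: 'k ^ 3) $ i * v $ i) = 2 *s v" for v :: "'k ^ 3"
      by (simp add: vec_eq_iff)
    then have "(\<Prod>i\<in>UNIV. ((\<chi> i. 2) :: 'k ^ 3) $ i ^ Poly_Mapping.lookup m i) = 2 ^ d"
      using that by (intro diagonal_semi_invariant[of "lin_subst A F"])
        (simp_all add: vec.scale homogeneous_teval[OF assms])
    then have "(2::'k) ^ (\<Sum>i\<in>UNIV. Poly_Mapping.lookup m i) = 2 ^ d"
      by (simp add: power_sum)
    then have "of_nat (2 ^ (\<Sum>i\<in>UNIV. Poly_Mapping.lookup m i)) = (of_nat (2 ^ d) :: 'k)"
      by simp
    then show ?thesis
      unfolding of_nat_eq_iff by simp
  qed
  then show ?thesis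
    by (simp add: homogeneous_def)
qed

text \<open>Otherwise the \<open>i\<close>-th coordinate point would be singular.\<close>

lemma nonsingular_vertex_monomial:
  fixes F :: "'k::field_char_0 tpoly"
  assumes F: "nonsingular_plane_curve d F" and P: "invertible P" and d: "d > 0"
  shows "\<exists>j. Poly_Mapping.single i (d - 1) + Poly_Mapping.single j 1 \<in> Poly_Mapping.keys (lin_subst P F)"
proof -
  define G where "G = lin_subst P F"
  have hom: "homogeneous d G"
    using F by (simp add: G_def nonsingular_plane_curve_def homogeneous_lin_subst)
  define e :: "'k ^ 3" where "e = axis i 1"
  have "e \<noteq> 0" by (simp add: e_def)
  then have Pe: "P *v e \<noteq> 0"
    using P by (metis invertible_def matrix_left_invertible_ker)
  have e0: "e $ j = 0" if "j \<noteq> i" for j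
    using that by (simp add: e_def axis_def)
  show ?thesis
  proof (cases "teval G e = 0")
    \<comment> \<open>Off the curve, the form contains X_i^d, which is the case j = i.\<close>
    case False
    then obtain m where m: "m \<in> Poly_Mapping.keys G" "(\<Prod>j\<in>UNIV. e $ j ^ Poly_Mapping.lookup m j) \<noteq> 0"
      unfolding teval_def by (metis (no_types, lifting) mult_zero_right sum.neutral)
    then have nz: "e $ j ^ Poly_Mapping.lookup m j \<noteq> 0" for j
      by simp
    then have 0: "Poly_Mapping.lookup m j = 0" if "j \<noteq> i" for j
      using nz[of j] e0[OF that] by simp
    have "(\<Sum>j\<in>UNIV. Poly_Mapping.lookup m j) = d"
      using hom m by (simp add: homogeneous_def)
    then have "Poly_Mapping.lookup m i = d"
      by (subst (asm) sum.remove[of UNIV i]) (auto simp: 0)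
    then have "m = Poly_Mapping.single i (d - 1) + Poly_Mapping.single i 1"
      using 0 d by (intro poly_mapping_eqI) (auto simp: lookup_add lookup_single when_def)
    then show ?thesis
      using m unfolding G_def by blast
  next
    case True
    then obtain w where "poly (pderiv (line_poly F (P *v e) w)) 0 \<noteq> 0"
      using nonsingular_plane_curveD[OF F Pe] by (auto simp: G_def)
    moreover obtain u where "w = P *v u"
      using P by (metis invertible_def matrix_vector_mul_assoc matrix_vector_mul_lid)
    ultimately have "poly (pderiv (line_poly G e u)) 0 \<noteq> 0"
      by (simp add: G_def line_poly_lin_subst)
    then obtain j where "teval (partial_deriv j G) e \<noteq> 0"
      unfolding pderiv_line_poly by (metis (no_types, lifting) mult_zero_right sum.neutral)
    then obtain m where m: "m \<in> Poly_Mapping.keys G" and nz: "of_nat (Poly_Mapping.lookup m j) *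
         Poly_Mapping.lookup G m * (e $ j ^ (Poly_Mapping.lookup m j - 1) *
         (\<Prod>k\<in>UNIV - {j}. e $ k ^ Poly_Mapping.lookup m k)) \<noteq> 0"
      unfolding teval_partial_deriv by (metis (no_types, lifting) sum.neutral)
    have j: "Poly_Mapping.lookup m j > 0"
      using nz by (auto intro: Nat.gr0I)
    \<comment> \<open>The rest of the monomial after removing one factor X_j does not vanish at e,
      so it is a pure power of X_i.\<close>
    define n where "n = m - Poly_Mapping.single j 1"
    have nz': "e $ k ^ Poly_Mapping.lookup n k \<noteq> 0" for k
      using nz by (cases "k = j") (auto simp: n_def lookup_minus lookup_single)
    then have 0: "Poly_Mapping.lookup n k = 0" if "k \<noteq> i" for k
      using nz'[of k] e0[OF that] by simp
    have m_eq: "m = n + Poly_Mapping.single j 1"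
      using j by (intro poly_mapping_eqI) (auto simp: n_def lookup_add lookup_minus lookup_single when_def)
    have "(\<Sum>k\<in>UNIV. Poly_Mapping.lookup m k) = d"
      using hom m by (simp add: homogeneous_def)
    then have "(\<Sum>k\<in>UNIV. Poly_Mapping.lookup n k) + 1 = d"
      by (subst (asm) m_eq) (simp add: lookup_add sum.distrib lookup_single when_def)
    then have "Poly_Mapping.lookup n i = d - 1"
      by (subst (asm) sum.remove[of UNIV i]) (auto simp: 0)
    then have "n = Poly_Mapping.single i (d - 1)"
      using 0 by (intro poly_mapping_eqI) (auto simp: lookup_single when_def)
    then show ?thesis
      using m m_eq unfolding G_def by metis
  qed
qed

section \<open>The normal form\<close>

lemma UNIV_3_distinct:
  fixes p q r :: 3
  assumes "p \<noteq> q" "p \<noteq> r" "q \<noteq> r"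
  shows "UNIV = {p, q, r}"
proof -
  have "card {p, q, r} = CARD(3)"
    using assms by simp
  then show ?thesis
    by (metis card_subset_eq finite_code subset_UNIV)
qed

lemma ex_distinct_3: "\<exists>p q. p \<noteq> q \<and> p \<noteq> r \<and> q \<noteq> (r :: 3)"
proof -
  consider "r = 1" | "r = 2" | "r = 3"
    using exhaust_3[of r] by blast
  then show ?thesis
    by cases (rule exI[of _ 2] exI[of _ 1], rule exI[of _ 3] exI[of _ 2], simp)+
qed

text \<open>The monomials \<open>X_i^N X_\<phi>(i)\<close> force \<open>a_\<phi>(i)^l\<close> to be independent of \<open>i\<close>. As \<open>a\<close> is
  of order \<open>l N\<close> modulo scalars, \<open>\<phi>\<close> is neither surjective nor constant.\<close>

lemma vertex_map_shape:
  fixes a :: "3 \<Rightarrow> 'k::field"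
  assumes nz: "\<And>i. a i \<noteq> 0" and c: "\<And>i. a i ^ N * a (\<phi> i) = c"
    and lN: "l dvd N"
    and ord: "\<And>k. (\<exists>s. \<forall>i. a i ^ k = s) \<longleftrightarrow> l * N dvd k"
    and less: "0 < l" "l < l * N" "N < l * N"
  obtains p q r where "p \<noteq> q" "p \<noteq> r" "q \<noteq> r" "\<phi> p = p" "\<phi> q = p" "\<phi> r = q"
proof -
  obtain s where s: "\<And>i. a i ^ (l * N) = s"
    using ord[of "l * N"] by auto
  then have "s \<noteq> 0"
    using nz by (metis power_not_zero)
  \<comment> \<open>The l-th power of the relation \<open>c\<close> turns a_i^N into the scalar
    s.\<close>
  have phi: "a (\<phi> i) ^ l = c ^ l / s" for i
  proof -
    have "c ^ l = (a i ^ N * a (\<phi> i)) ^ l"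
      by (simp only: c)
    also have "\<dots> = a i ^ (l * N) * a (\<phi> i) ^ l"
      by (simp add: power_mult_distrib mult.commute[of l N] power_mult)
    finally show ?thesis
      using \<open>s \<noteq> 0\<close> by (simp add: s)
  qed
  have not_l: "\<not> (\<exists>s. \<forall>i. a i ^ l = s)" and not_N: "\<not> (\<exists>s. \<forall>i. a i ^ N = s)"
    using ord less by (auto dest!: dvd_imp_le)
  have not_const: "\<exists>i. a (\<phi> i) \<noteq> b" if "b \<noteq> 0" for b
  proof (rule ccontr)
    assume "\<not> (\<exists>i. a (\<phi> i) \<noteq> b)"
    then have "a i ^ N = c / b" for i
      using c[of i] that by (auto simp: field_simps)
    then show False using not_N by blast
  qed
  have "\<not> surj \<phi>"
  proof
    assume "surj \<phi>"
    then have "a i ^ l = c ^ l / s" for i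
      using phi by (metis surjD)
    then show False using not_l by blast
  qed
  then obtain r where r: "\<And>i. \<phi> i \<noteq> r" by (metis surjI surj_def)
  obtain u v where uv: "u \<noteq> v" "u \<noteq> r" "v \<noteq> r"
    using ex_distinct_3[of r] by blast
  have phi_uv: "\<phi> i = u \<or> \<phi> i = v" for i
    using UNIV_3_distinct[OF uv] r[of i] by blast
  \<comment> \<open>Both u and v are values of \<phi>, because a constant \<phi> is excluded by
    \<open>not_const\<close>.\<close>
  have "a u ^ l = a v ^ l"
    using phi phi_uv not_const[OF nz, of u] not_const[OF nz, of v] by metis
  then have "a u ^ N = a v ^ N"
    using lN by (auto simp: power_mult)
  then have eq: "a (\<phi> u) = a (\<phi> v)"
    using c[of u] c[of v] nz[of v] by (metis mult_left_cancel power_not_zero)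
  have phi_eq: "\<phi> u = \<phi> v"
  proof (rule ccontr)
    assume "\<phi> u \<noteq> \<phi> v"
    then have "a u = a v"
      using eq phi_uv[of u] phi_uv[of v] by auto
    then show False
      using not_const[OF nz, of u] phi_uv by metis
  qed
  have r_neq: "\<phi> r \<noteq> \<phi> u"
  proof
    assume "\<phi> r = \<phi> u"
    then have "\<phi> i = \<phi> u" for i
      using phi_eq UNIV_3_distinct[OF uv] by (metis UNIV_I insert_iff singletonD)
    then show False
      using not_const[OF nz, of "\<phi> u"] by metis
  qed
  \<comment> \<open>The common image of u and v becomes p, the other one of the two becomes q, and r
    is the index missed by \<phi>.\<close>
  from phi_uv[of u] show ?thesis
  proof
    assume "\<phi> u = u"
    then show ?thesis
      using that[of u v r] uv phi_eq r_neq phi_uv[of r] by auto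
  next
    assume "\<phi> u = v"
    then show ?thesis
      using that[of v u r] uv phi_eq r_neq phi_uv[of r] by auto
  qed
qed

text \<open>Normalized to a_p = 1, all weights are powers of b, because e = b^(-N), and b has order
  divisible by l N. Invariance then reads j = N k modulo l N. So N divides j, and j \<le> N + 1
  leaves j = 0 with l dividing k, or j = N, where k = 0 would make l N divide N.\<close>

lemma invariant_monomials:
  fixes a :: "3 \<Rightarrow> 'k::field"
  assumes nz: "\<And>i. a i \<noteq> 0" and pqr: "p \<noteq> q" "p \<noteq> r" "q \<noteq> r"
    and p: "a p ^ N * a p = c" and q: "a q ^ N * a p = c" and r: "a r ^ N * a q = c"
    and ord: "\<And>k. (\<exists>s. \<forall>i. a i ^ k = s) \<longleftrightarrow> l * N dvd k"
    and l: "l \<ge> 2" "N \<ge> 2"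
    and m: "a p ^ i * a r ^ j * a q ^ k = c" "i + j + k = Suc N"
  shows "j = N \<and> k = 1 \<or> j = 0 \<and> l dvd k"
proof -
  define b e where "b = a r / a p" and "e = a q / a p"
  have nz': "b \<noteq> 0" "e \<noteq> 0"
    by (simp_all add: b_def e_def nz)
  have a_eq: "a r = b * a p" "a q = e * a p"
    by (simp_all add: b_def e_def nz)
  have c: "c = a p ^ Suc N"
    using p by (simp add: mult.commute)
  have be: "b ^ N * e = 1"
  proof -
    have "(b ^ N * e) * a p ^ Suc N = a r ^ N * a q"
      by (simp add: a_eq power_mult_distrib mult_ac)
    then show ?thesis using r c nz[of p] by simp
  qed
  have "(b ^ j * e ^ k) * a p ^ (i + j + k) = a p ^ i * a r ^ j * a q ^ k"
    by (simp add: a_eq power_mult_distrib power_add mult_ac)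
  then have bjek: "b ^ j * e ^ k = 1"
    using m c nz[of p] by simp
  have "(b ^ N * e) ^ k = 1"
    using be by simp
  then have "b ^ (N * k) * e ^ k = 1"
    by (simp add: power_mult_distrib power_mult)
  then have eq: "b ^ j = b ^ (N * k)"
    using bjek nz' by (metis mult_right_cancel power_not_zero)
  \<comment> \<open>Here e^t = 1 follows as well, so all a_i^t coincide and \<open>ord\<close>
    applies.\<close>
  have b_ord: "l * N dvd t" if "b ^ t = 1" for t
  proof -
    have "(b ^ N * e) ^ t = 1"
      using be by simp
    then have "e ^ t = 1"
      using power_power_eq_1[OF that, of N] by (simp add: power_mult_distrib power_commute)
    then have "a i ^ t = a p ^ t" for i
      using that UNIV_3_distinct[OF pqr] by (metis UNIV_I a_eq insert_iff mult_1 power_mult_distrib singletonD)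
    then show ?thesis
      using ord by blast
  qed
  have "[j = N * k] (mod l * N)"
  proof (cases "j \<le> N * k")
    case True
    then have "b ^ (N * k - j) = 1"
      using eq nz' by (simp add: power_diff)
    then show ?thesis
      using b_ord True by (metis cong_altdef_nat cong_sym)
  next
    case False
    then have "b ^ (j - N * k) = 1"
      using eq nz' by (simp add: power_diff)
    then show ?thesis
      using b_ord False by (metis cong_altdef_nat nat_le_linear)
  qed
  moreover from this have "N dvd j"
    by (metis cong_dvd_iff cong_dvd_modulus_nat dvd_triv_left dvd_triv_right)
  then obtain u where u: "j = N * u"
    by blast
  moreover have "u < 2"
  proof (rule ccontr)
    assume "\<not> u < 2"
    then have "N * 2 \<le> j"
      unfolding u by (intro mult_left_mono) auto
    then show False using m(2) l by linarith
  qed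
  then consider "u = 0" | "u = 1"
    by linarith
  then show ?thesis
  proof cases
    case 1
    then have "N * l dvd N * k"
      using calculation by (simp add: cong_0_iff cong_sym_eq[of 0] mult.commute)
    then show ?thesis
      using 1 u l by simp
  next
    case 2
    have "k \<noteq> 0"
    proof
      assume "k = 0"
      then have "l * N dvd 1 * N"
        using calculation 2 by (simp add: cong_0_iff)
      then have "l * N \<le> N"
        using l by (auto dest: dvd_imp_le)
      moreover have "2 * N \<le> l * N"
        using l by (intro mult_right_mono) auto
      ultimately show False using l by linarith
    qed
    then show ?thesis
      using m(2) 2 u by simp
  qed
qed

section \<open>Reduction of the curve to the normal form\<close>

definition normal_form :: "nat \<Rightarrow> nat \<Rightarrow> 'k \<Rightarrow> (nat \<Rightarrow> 'k) \<Rightarrow> 'k::comm_ring_1 tpoly" where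
  "normal_form d l \<alpha> \<beta> =
     tvar 1 ^ d + tvar 2 ^ (d - 1) * tvar 3 + tconst \<alpha> * tvar 1 * tvar 3 ^ (d - 1)
     + (\<Sum>j | 2 \<le> j \<and> j \<le> d - 2 \<and> l dvd j. tconst (\<beta> j) * tvar 1 ^ (d - j) * tvar 3 ^ j)"

lemma teval_normal_form:
  "teval (normal_form d l \<alpha> \<beta>) v = v $ 1 ^ d + v $ 2 ^ (d - 1) * v $ 3 + \<alpha> * v $ 1 * v $ 3 ^ (d - 1)
     + (\<Sum>j | 2 \<le> j \<and> j \<le> d - 2 \<and> l dvd j. \<beta> j * v $ 1 ^ (d - j) * v $ 3 ^ j)"
  by (simp add: normal_form_def)

text \<open>Homogeneity leaves Y and the monomials M k with k \<le> d divisible by l. As l divides d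
  - 1 and l \<ge> 2, neither k = d nor k = 1 occurs, so k is 0, d - 1 or in the range of the
  sum.\<close>

lemma teval_monomial_support:
  fixes F :: "'k::field_char_0 tpoly"
  assumes d: "d \<ge> 5" "2 \<le> l" "l dvd d - 1" and pqr: "p \<noteq> q" "p \<noteq> r" "q \<noteq> (r :: 3)"
    and hom: "homogeneous d F"
    and supp: "\<And>m. m \<in> Poly_Mapping.keys F \<Longrightarrow>
      Poly_Mapping.lookup m r = d - 1 \<and> Poly_Mapping.lookup m q = 1 \<or>
      Poly_Mapping.lookup m r = 0 \<and> l dvd Poly_Mapping.lookup m q"
  defines "M k \<equiv> Poly_Mapping.single p (d - k) + Poly_Mapping.single q k"
    and "Y \<equiv> Poly_Mapping.single r (d - 1) + Poly_Mapping.single q 1"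
  shows "teval F v = Poly_Mapping.lookup F (M 0) * v $ p ^ d
     + Poly_Mapping.lookup F Y * v $ r ^ (d - 1) * v $ q
     + Poly_Mapping.lookup F (M (d - 1)) * v $ p * v $ q ^ (d - 1)
     + (\<Sum>k | 2 \<le> k \<and> k \<le> d - 2 \<and> l dvd k. Poly_Mapping.lookup F (M k) * v $ p ^ (d - k) * v $ q ^ k)"
proof -
  note UNIV = UNIV_3_distinct[OF pqr]
  define K where "K = {k. k \<le> d \<and> l dvd k}"
  have "\<not> l dvd d"
  proof
    assume "l dvd d"
    then have "l dvd d - (d - 1)"
      using d(3) by (rule dvd_diff_nat)
    moreover have "d - (d - 1) = 1"
      using d by simp
    ultimately show False using d by simp
  qed
  then have K: "K = insert 0 (insert (d - 1) {k. 2 \<le> k \<and> k \<le> d - 2 \<and> l dvd k})"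
  proof -
    have "k \<in> K \<longleftrightarrow> k = 0 \<or> k = d - 1 \<or> 2 \<le> k \<and> k \<le> d - 2 \<and> l dvd k" for k
    proof -
      have "k \<noteq> d" "k \<noteq> 1" if "l dvd k"
        using that \<open>\<not> l dvd d\<close> d by auto
      then show ?thesis
        using d by (auto simp: K_def)
    qed
    then show ?thesis by blast
  qed
  have lookup_M: "Poly_Mapping.lookup (M k) p = d - k" "Poly_Mapping.lookup (M k) q = k"
    "Poly_Mapping.lookup (M k) r = 0" for k
    using pqr by (simp_all add: M_def lookup_add lookup_single)
  have lookup_Y: "Poly_Mapping.lookup Y p = 0" "Poly_Mapping.lookup Y q = 1"
    "Poly_Mapping.lookup Y r = d - 1"
    using pqr by (simp_all add: Y_def lookup_add lookup_single)
  have keys: "Poly_Mapping.keys F \<subseteq> insert Y (M ` K)"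
  proof
    fix m assume m: "m \<in> Poly_Mapping.keys F"
    have eqI: "m = n" if "Poly_Mapping.lookup m p = Poly_Mapping.lookup n p"
      "Poly_Mapping.lookup m q = Poly_Mapping.lookup n q" "Poly_Mapping.lookup m r = Poly_Mapping.lookup n r" for n
      using that UNIV by (intro poly_mapping_eqI) (metis UNIV_I insert_iff singletonD)
    have sum: "Poly_Mapping.lookup m p + (Poly_Mapping.lookup m q + Poly_Mapping.lookup m r) = d"
      using hom m pqr unfolding homogeneous_def UNIV by simp
    from supp[OF m] show "m \<in> insert Y (M ` K)"
    proof
      assume *: "Poly_Mapping.lookup m r = d - 1 \<and> Poly_Mapping.lookup m q = 1"
      then have "m = Y"
        using sum d by (intro eqI) (simp_all add: lookup_Y)
      then show ?thesis by simp
    next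
      assume *: "Poly_Mapping.lookup m r = 0 \<and> l dvd Poly_Mapping.lookup m q"
      then have "m = M (Poly_Mapping.lookup m q)"
        using sum by (intro eqI) (simp_all add: lookup_M)
      moreover have "Poly_Mapping.lookup m q \<in> K"
        using * sum by (simp add: K_def)
      ultimately show ?thesis by blast
    qed
  qed
  have "finite K" by (simp add: K_def)
  have "Y \<notin> M ` K"
  proof
    assume "Y \<in> M ` K"
    then have "Poly_Mapping.lookup Y r = 0"
      using lookup_M(3) by auto
    then show False using lookup_Y(3) d by simp
  qed
  have inj: "inj_on M K"
    by (rule inj_onI) (metis lookup_M(2))
  have Mv: "(\<Prod>i\<in>UNIV. v $ i ^ Poly_Mapping.lookup (M k) i) = v $ p ^ (d - k) * v $ q ^ k" for k
    unfolding UNIV using pqr by (simp add: lookup_M)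
  have Yv: "(\<Prod>i\<in>UNIV. v $ i ^ Poly_Mapping.lookup Y i) = v $ r ^ (d - 1) * v $ q"
    unfolding UNIV using pqr by (simp add: lookup_Y)
  have "teval F v = Poly_Mapping.lookup F Y * (v $ r ^ (d - 1) * v $ q)
     + (\<Sum>k\<in>K. Poly_Mapping.lookup F (M k) * (v $ p ^ (d - k) * v $ q ^ k))"
    using \<open>finite K\<close> \<open>Y \<notin> M ` K\<close>
    by (subst teval_superset[OF _ keys]) (simp_all add: sum.reindex[OF inj] Mv Yv)
  moreover have "finite {k. 2 \<le> k \<and> k \<le> d - 2 \<and> l dvd k}"
    using \<open>finite K\<close> unfolding K by simp
  moreover have "d - 1 \<notin> {k. 2 \<le> k \<and> k \<le> d - 2 \<and> l dvd k}" "0 \<notin> insert (d - 1) {k. 2 \<le> k \<and> k \<le> d - 2 \<and> l dvd k}"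
    "d - (d - 1) = 1"
    using d by auto
  ultimately show ?thesis
    unfolding K by (simp only: sum.insert finite_insert simp_thms not_False_eq_True) (simp add: mult_ac add_ac)
qed

lemma normal_form_of_ord:
  fixes F :: "'k::{alg_closed_field, field_char_0} tpoly"
  assumes d: "d \<ge> 5" "2 \<le> l" "l \<le> d - 1" "l dvd d - 1"
    and F: "nonsingular_plane_curve d F"
    and A: "invertible A" "c \<noteq> 0" "lin_subst A F = tconst c * F"
    and ord: "\<And>k. (\<exists>s. matrix_power A k = mat s) \<longleftrightarrow> l * (d - 1) dvd k"
  shows "\<exists>T \<alpha> \<beta>. invertible T \<and> \<alpha> \<noteq> 0 \<and> lin_subst T F = normal_form d l \<alpha> \<beta>"
proof -
  define N where "N = d - 1"
  have N: "N \<ge> 4" "d = Suc N" using d by (simp_all add: N_def)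
  obtain s where s: "matrix_power A (l * N) = mat s"
    using ord[of "l * N"] by (auto simp: N_def)
  then have "s \<noteq> 0"
    using invertible_matrix_power[OF A(1), of "l * N"] invertible_matD by metis
  then obtain P :: "'k ^ 3 ^ 3" and a where P: "invertible P" "A ** P = P ** diag_matrix a"
    using diagonalizable_finite_order[OF _ s] d N by auto
  obtain P' where P': "P' ** P = mat 1" "P ** P' = mat 1"
    using P unfolding invertible_def by blast
  define G where "G = lin_subst P F"
  have "homogeneous d G"
    using F by (simp add: G_def nonsingular_plane_curve_def homogeneous_lin_subst)
  have pow: "matrix_power A k ** P = P ** diag_matrix (\<chi> i. a $ i ^ k)" for k
  proof (induction k)
    case (Suc k)
    have "diag_matrix (\<chi> i. a $ i ^ k) ** diag_matrix a = diag_matrix (\<chi> i. a $ i ^ Suc k)"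
      by (simp add: matrix_eq vec_eq_iff mult_ac flip: matrix_vector_mul_assoc)
    then show ?case
      by (metis P(2) Suc.IH matrix_mul_assoc matrix_power.simps(2))
  qed (simp add: matrix_eq vec_eq_iff flip: matrix_vector_mul_assoc)
  \<comment> \<open>Transfers the hypothesis on the order of A to the diagonal entries.\<close>
  have scalar: "matrix_power A k = mat s \<longleftrightarrow> (\<forall>i. a $ i ^ k = s)" for k s
  proof -
    have "matrix_power A k = mat s \<longleftrightarrow> matrix_power A k ** P = mat s ** P"
      using P'(2) by (metis matrix_mul_assoc matrix_mul_rid)
    also have "mat s ** P = P ** mat s"
      by (simp add: matrix_eq vec.scale flip: matrix_vector_mul_assoc)
    also have "matrix_power A k ** P = P ** mat s \<longleftrightarrow> diag_matrix (\<chi> i. a $ i ^ k) = mat s"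
      unfolding pow using P'(1) by (metis matrix_mul_assoc matrix_mul_lid)
    also have "\<dots> \<longleftrightarrow> (\<forall>i. a $ i ^ k = s)"
      by (auto simp: diag_matrix_def mat_def vec_eq_iff)
    finally show ?thesis .
  qed
  have a_ord: "(\<exists>s. \<forall>i. a $ i ^ k = s) \<longleftrightarrow> l * N dvd k" for k
    using ord[of k] scalar by (simp add: N_def)
  have a_nz: "a $ i \<noteq> 0" for i
    using s scalar[of "l * N" s] \<open>s \<noteq> 0\<close> d N by (metis mult_is_0 not_numeral_le_zero zero_power zero_less_iff_neq_zero)
  have "teval F (A *v v) = c * teval F v" for v
    using arg_cong[OF A(3), of "\<lambda>F. teval F v"] by simp
  moreover have "P *v (diag_matrix a *v v) = A *v (P *v v)" for v
    by (simp only: matrix_vector_mul_assoc P(2))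
  ultimately have "teval G (\<chi> i. a $ i * v $ i) = c * teval G v" for v
    by (simp add: G_def) 
  note inv = diagonal_semi_invariant[of G a, OF this]
  obtain \<phi> where phi: "\<And>i. Poly_Mapping.single i N + Poly_Mapping.single (\<phi> i) 1 \<in> Poly_Mapping.keys G"
    using nonsingular_vertex_monomial[OF F P(1)] d unfolding G_def N_def by (metis gr0I not_numeral_le_zero)
  have c: "a $ i ^ N * a $ \<phi> i = c" for i
    using inv[OF phi[of i]]
    by (simp add: lookup_add power_add prod.distrib lookup_single when_def if_distrib[of "power _"] cong: if_cong)
  have less: "0 < l" "l < l * N" "N < l * N"
    using d N by auto
  obtain p q r where pqr: "p \<noteq> q" "p \<noteq> r" "q \<noteq> r" "\<phi> p = p" "\<phi> q = p" "\<phi> r = q"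
    using vertex_map_shape[of "($) a" N \<phi> c l] a_nz c a_ord less d by (auto simp: N_def)
  note UNIV = UNIV_3_distinct[OF pqr(1-3)]
  have supp: "Poly_Mapping.lookup m r = d - 1 \<and> Poly_Mapping.lookup m q = 1 \<or>
      Poly_Mapping.lookup m r = 0 \<and> l dvd Poly_Mapping.lookup m q" if "m \<in> Poly_Mapping.keys G" for m
    unfolding N_def[symmetric]
  proof (rule invariant_monomials[of "($) a" p q r N c l "Poly_Mapping.lookup m p"])
    show "a $ p ^ Poly_Mapping.lookup m p * a $ r ^ Poly_Mapping.lookup m r * a $ q ^ Poly_Mapping.lookup m q = c"
      using inv[OF that] pqr unfolding UNIV by (simp add: mult_ac)
    show "Poly_Mapping.lookup m p + Poly_Mapping.lookup m r + Poly_Mapping.lookup m q = Suc N"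
      using \<open>homogeneous d G\<close> that pqr unfolding homogeneous_def UNIV N(2)[symmetric] by auto
  qed (use a_nz pqr c[of p] c[of q] c[of r] a_ord d N in auto)
  define M where "M k = Poly_Mapping.single p (d - k) + Poly_Mapping.single q k" for k
  define Y where "Y = Poly_Mapping.single r (d - 1) + Poly_Mapping.single q 1"
  have evG: "teval G v = Poly_Mapping.lookup G (M 0) * v $ p ^ d
     + Poly_Mapping.lookup G Y * v $ r ^ (d - 1) * v $ q
     + Poly_Mapping.lookup G (M (d - 1)) * v $ p * v $ q ^ (d - 1)
     + (\<Sum>k | 2 \<le> k \<and> k \<le> d - 2 \<and> l dvd k. Poly_Mapping.lookup G (M k) * v $ p ^ (d - k) * v $ q ^ k)" for v
    unfolding M_def Y_def
    by (rule teval_monomial_support[OF d(1,2,4) pqr(1-3) \<open>homogeneous d G\<close> supp])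
  \<comment> \<open>The three vertex monomials are the ones that must occur in the normal form; two
    coefficients get scaled to 1, the third yields \<alpha>.\<close>
  have "M 0 = Poly_Mapping.single p N + Poly_Mapping.single (\<phi> p) 1"
    "M (d - 1) = Poly_Mapping.single q N + Poly_Mapping.single (\<phi> q) 1"
    "Y = Poly_Mapping.single r N + Poly_Mapping.single (\<phi> r) 1"
    by (simp_all add: M_def Y_def pqr(4-6) N(2) add.commute flip: single_add)
  then have nz: "Poly_Mapping.lookup G (M 0) \<noteq> 0" "Poly_Mapping.lookup G (M (d - 1)) \<noteq> 0" "Poly_Mapping.lookup G Y \<noteq> 0"
    using phi by (metis in_keys_iff)+
  obtain x where x: "x ^ d = inverse (Poly_Mapping.lookup G (M 0))"
    using nth_root_exists[of d] d by auto
  obtain y where y: "y ^ (d - 1) = inverse (Poly_Mapping.lookup G Y)"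
    using nth_root_exists[of "d - 1"] d by auto
  have xy: "x \<noteq> 0" "y \<noteq> 0"
    using x y nz d by (auto simp: zero_power)
  \<comment> \<open>Q renames p, r, q as the coordinates X, Y, Z; the factors x and y normalize the
    coefficients of X^d and Y^(d-1) Z, while Z is left unscaled.\<close>
  define Q :: "'k ^ 3 ^ 3" where "Q = (\<chi> i j. if i = p \<and> j = 1 then x
    else if i = r \<and> j = 2 then y else if i = q \<and> j = 3 then 1 else 0)"
  have Q: "(Q *v v) $ p = x * v $ 1" "(Q *v v) $ r = y * v $ 2" "(Q *v v) $ q = v $ 3" for v
    using pqr by (simp_all add: Q_def matrix_vector_mult_def sum_3)
  have "v = 0" if "Q *v v = 0" for v
    using Q[of v] that xy by (simp add: vec_eq_iff forall_3)
  then have "invertible Q"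
    using matrix_left_invertible_ker[of Q] invertible_left_inverse[of Q] by blast
  define \<alpha> where "\<alpha> = Poly_Mapping.lookup G (M (d - 1)) * x"
  define \<beta> where "\<beta> k = Poly_Mapping.lookup G (M k) * x ^ (d - k)" for k
  have "lin_subst (P ** Q) F = normal_form d l \<alpha> \<beta>"
  proof (rule tpoly_eqI)
    fix v :: "'k ^ 3"
    have "Poly_Mapping.lookup G (M 0) * (x * v $ 1) ^ d = v $ 1 ^ d"
      using nz by (simp add: power_mult_distrib x flip: mult.assoc)
    moreover have "Poly_Mapping.lookup G Y * (y * v $ 2) ^ (d - 1) = v $ 2 ^ (d - 1)"
      using nz by (simp only: power_mult_distrib y) (simp flip: mult.assoc)
    ultimately have "teval G (Q *v v) = teval (normal_form d l \<alpha> \<beta>) v"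
      unfolding evG Q teval_normal_form \<alpha>_def \<beta>_def
      by (simp only: power_mult_distrib mult_ac)
    moreover have "teval (lin_subst (P ** Q) F) v = teval G (Q *v v)"
      by (simp add: G_def matrix_vector_mul_assoc)
    ultimately show "teval (lin_subst (P ** Q) F) v = teval (normal_form d l \<alpha> \<beta>) v"
      by simp
  qed
  moreover have "invertible (P ** Q)"
    using P(1) \<open>invertible Q\<close> by (rule invertible_mult)
  moreover have "\<alpha> \<noteq> 0"
    using nz xy by (simp add: \<alpha>_def)
  ultimately show ?thesis
    by blast
qed

section \<open>Automorphisms of the normal form\<close>

text \<open>For a non-singular curve of this shape (0:1:0) is an inner Galois point: projection from
  it is a cyclic cover of degree N, since Y enters only through Y^N.\<close>

definition galois_form :: "nat \<Rightarrow> (nat \<Rightarrow> 'k) \<Rightarrow> 'k ^ 3 \<Rightarrow> 'k::comm_semiring_1" where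
  "galois_form N \<gamma> v = v $ 2 ^ N * v $ 3 + (\<Sum>k\<le>Suc N. \<gamma> k * v $ 1 ^ (Suc N - k) * v $ 3 ^ k)"

text \<open>The homology \<open>diag(1, \<xi>, 1)\<close> and its conjugate by \<open>B\<close> both preserve the form. If their centres
  \<open>e\<close> and \<open>Q = B e\<close> were distinct, the restriction to the line joining them would contradict
  the lemma \<open>no_second_homology\<close>.\<close>

lemma galois_form_fixed_centre:
  fixes B :: "'k::{alg_closed_field, field_char_0} ^ 3 ^ 3"
  assumes N: "N \<ge> 4" and \<gamma>: "\<gamma> 0 = 1" and B: "invertible B" and c: "c \<noteq> 0"
    and inv: "\<And>v. galois_form N \<gamma> (B *v v) = c * galois_form N \<gamma> v"
  shows "B $ 1 $ 2 = 0 \<and> B $ 3 $ 2 = 0"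
proof -
  define f where "f = galois_form N \<gamma>"
  define e :: "'k ^ 3" where "e = axis 2 1"
  define Q where "Q = B *v e"
  have e: "e $ 1 = 0" "e $ 2 = 1" "e $ 3 = 0"
    by (simp_all add: e_def axis_def)
  have Q: "Q $ i = B $ i $ 2" for i
    by (simp add: Q_def matrix_vector_mult_def sum_3 e)
  obtain B' where B': "B' ** B = mat 1" "B ** B' = mat 1"
    using B unfolding invertible_def by blast
  have "f e = 0"
    by (simp add: f_def galois_form_def e zero_power power_0_left)
  then have fQ: "f Q = 0"
    using inv[of e] by (simp add: Q_def f_def)
  \<comment> \<open>A primitive N-th root of unity; N \<ge> 4 ensures \<xi>^2 \<noteq> 1.\<close>
  obtain \<xi> :: 'k where "\<And>k. \<xi> ^ k = 1 \<longleftrightarrow> N dvd k"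
    using ex_primitive_root_of_unity[of N] N by auto
  then have \<xi>: "\<xi> ^ N = 1" "\<xi>\<^sup>2 \<noteq> 1"
    using N by (auto dest: dvd_imp_le)
  \<comment> \<open>This is diag(1, \<xi>, 1), written as a displacement along e so that its
    conjugate by B is a displacement along Q.\<close>
  define D where "D v = v + ((\<xi> - 1) * v $ 2) *s e" for v :: "'k ^ 3"
  have fD: "f (D v) = f v" for v
  proof -
    have "D v $ 1 = v $ 1" "D v $ 2 = \<xi> * v $ 2" "D v $ 3 = v $ 3"
      by (simp_all add: D_def e algebra_simps)
    then show ?thesis
      by (simp add: f_def galois_form_def power_mult_distrib \<xi>)
  qed
  define \<kappa> where "\<kappa> = (\<xi> - 1) * (B' *v e) $ 2"
  have sym: "f (s *s e + (\<kappa> * s + \<xi> * t) *s Q) = f (s *s e + t *s Q)" for s t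
  proof -
    define v where "v = s *s e + t *s Q"
    have BB: "B *v (B' *v u) = u" "B' *v (B *v u) = u" for u
      by (simp_all add: matrix_vector_mul_assoc B')
    have "B' *v v = s *s (B' *v e) + t *s e"
      by (simp add: v_def Q_def vec.add vec.scale BB)
    then have "B *v D (B' *v v) = v + ((\<xi> - 1) * (s * (B' *v e) $ 2 + t)) *s Q"
      by (simp add: D_def vec.add vec.scale BB Q_def e v_def)
    also have "\<dots> = s *s e + (\<kappa> * s + \<xi> * t) *s Q"
      by (simp add: v_def \<kappa>_def vec_eq_iff algebra_simps)
    finally have "f (s *s e + (\<kappa> * s + \<xi> * t) *s Q) = c * f (D (B' *v v))"
      using inv[of "D (B' *v v)"] by (simp add: f_def)
    also have "\<dots> = c * f (B' *v v)"
      by (simp add: fD)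
    also have "\<dots> = f v"
      using inv[of "B' *v v"] by (simp add: f_def BB)
    finally show ?thesis
      by (simp add: v_def)
  qed
  define g where "g = (\<Sum>k\<le>Suc N. \<gamma> k * Q $ 1 ^ (Suc N - k) * Q $ 3 ^ k)"
  have g: "g = - (Q $ 2 ^ N * Q $ 3)"
    using fQ by (simp add: f_def galois_form_def g_def add_eq_0_iff)
  \<comment> \<open>As Q lies on the curve, \<open>g\<close> expresses the binary form at Q through
    the other coordinates; a factor \<open>Q $ 3\<close> splits off.\<close>
  have line: "f (s *s e + t *s Q) = Q $ 3 * (t * ((s + t * Q $ 2) ^ N - (t * Q $ 2) ^ N))" for s t
  proof -
    have "(\<Sum>k\<le>Suc N. \<gamma> k * (t * Q $ 1) ^ (Suc N - k) * (t * Q $ 3) ^ k) =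
        (\<Sum>k\<le>Suc N. t ^ Suc N * (\<gamma> k * Q $ 1 ^ (Suc N - k) * Q $ 3 ^ k))"
    proof (rule sum.cong)
      fix k assume "k \<in> {..Suc N}"
      then have "t ^ Suc N = t ^ (Suc N - k) * t ^ k"
        by (simp only: power_add[symmetric]) simp
      then show "\<gamma> k * (t * Q $ 1) ^ (Suc N - k) * (t * Q $ 3) ^ k = t ^ Suc N * (\<gamma> k * Q $ 1 ^ (Suc N - k) * Q $ 3 ^ k)"
        by (simp only: power_mult_distrib mult_ac)
    qed simp
    also have "\<dots> = t ^ Suc N * g"
      by (simp only: g_def sum_distrib_left)
    finally have "f (s *s e + t *s Q) = (s + t * Q $ 2) ^ N * (t * Q $ 3) + t ^ Suc N * g"
      by (simp add: f_def galois_form_def e)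
    then show ?thesis
      by (simp add: g power_mult_distrib algebra_simps)
  qed
  have "Q $ 3 = 0"
  proof (rule ccontr)
    assume "Q $ 3 \<noteq> 0"
    then show False
      using no_second_homology[OF N \<xi>, of \<kappa> "Q $ 2"] sym unfolding line by auto
  qed
  \<comment> \<open>With \<open>Q $ 3 = 0\<close>, the equation of the curve at Q reduces to its
    term X^(N+1).\<close>
  moreover have "Q $ 1 = 0"
  proof -
    have "(\<Sum>k\<le>Suc N. \<gamma> k * Q $ 1 ^ (Suc N - k) * Q $ 3 ^ k) = (\<Sum>k\<le>Suc N. if k = 0 then Q $ 1 ^ Suc N else 0)"
      by (rule sum.cong) (auto simp: \<gamma> \<open>Q $ 3 = 0\<close>)
    then have "Q $ 1 ^ Suc N = 0"
      using fQ \<open>Q $ 3 = 0\<close> \<gamma> by (simp add: f_def galois_form_def)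
    then show ?thesis by auto
  qed
  ultimately show ?thesis
    by (simp add: Q)
qed

text \<open>With the centre fixed, the coefficients of y^N and y^(N-1) clear the off-diagonal
  entries of the third and second row. What remains is an identity of binary forms, in which the
  missing X^N Z term clears the last entry.\<close>

lemma galois_form_automorphism:
  fixes B :: "'k::{alg_closed_field, field_char_0} ^ 3 ^ 3"
  assumes N: "N \<ge> 4" and \<gamma>: "\<gamma> 0 = 1" "\<gamma> 1 = 0" and B: "invertible B" and c: "c \<noteq> 0"
    and inv: "\<And>v. galois_form N \<gamma> (B *v v) = c * galois_form N \<gamma> v"
  obtains s \<eta> \<omega> where "s \<noteq> 0" "B = mat s ** diag_matrix (vector [1, \<eta>, \<omega>])"
    "\<eta> ^ N * \<omega> = 1" "\<And>k. k \<le> Suc N \<Longrightarrow> \<gamma> k \<noteq> 0 \<Longrightarrow> \<omega> ^ k = 1"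
proof -
  define b where "b i j = B $ i $ j" for i j
  define g where "g x z = (\<Sum>k\<le>Suc N. \<gamma> k * x ^ (Suc N - k) * z ^ k)" for x z
  have b0: "b 1 2 = 0" "b 3 2 = 0"
    using galois_form_fixed_centre[OF N \<gamma>(1) B c inv] by (simp_all add: b_def)
  have eq: "(b 2 1 * x + b 2 2 * y + b 2 3 * z) ^ N * (b 3 1 * x + b 3 3 * z) + g (b 1 1 * x + b 1 3 * z) (b 3 1 * x + b 3 3 * z)
     = c * (y ^ N * z + g x z)" for x y z
    using inv[of "vector [x, y, z]"] b0
    by (simp add: galois_form_def g_def matrix_vector_mult_def sum_3 b_def)
  have b22: "b 2 2 \<noteq> 0"
  proof
    assume "b 2 2 = 0"
    then have "B *v axis 2 1 = 0"
      using b0 by (simp add: vec_eq_iff forall_3 matrix_vector_mult_def sum_3 b_def axis_def)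
    then show False
      using B by (metis axis_eq_0_iff invertible_def matrix_left_invertible_ker zero_neq_one)
  qed
  have eq_y: "[:b 2 1 * x + b 2 3 * z, b 2 2:] ^ N * [:b 3 1 * x + b 3 3 * z:] + [:g (b 1 1 * x + b 1 3 * z) (b 3 1 * x + b 3 3 * z):]
     = monom (c * z) N + [:c * g x z:]" for x z
    using eq[of x _ z] by (intro poly_ext) (simp add: poly_monom algebra_simps)
  have "b 2 2 ^ N * (b 3 1 * x + b 3 3 * z) = c * z" for x z
    using arg_cong[OF eq_y[of x z], of "\<lambda>p. coeff p N"] N
    by (simp add: coeff_linear_power coeff_pCons mult_ac split: nat.splits)
  from this[of 1 0] this[of 0 1] have b3: "b 3 1 = 0" "b 2 2 ^ N * b 3 3 = c"
    using b22 by auto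
  then have b33: "b 3 3 \<noteq> 0"
    using c by auto
  obtain M where M: "N = Suc M" "M > 0"
    using N by (cases N) auto
  have linear: "coeff ([:u, w:] ^ N) M = of_nat N * w ^ M * u" for u w :: 'k
  proof -
    have "N choose M = N" "N - M = 1"
      by (simp_all add: M)
    then show ?thesis
      by (simp add: coeff_linear_power)
  qed
  have const: "coeff [:u:] M = 0" for u :: 'k
    using M by (simp add: coeff_pCons split: nat.splits)
  have "N \<noteq> M"
    by (simp add: M)
  \<comment> \<open>The coefficient of y^(N-1), absent on the right-hand side.\<close>
  have "of_nat N * b 2 2 ^ M * (b 2 1 * x + b 2 3 * z) * (b 3 1 * x + b 3 3 * z) = 0" for x z
    using arg_cong[OF eq_y[of x z], of "\<lambda>p. coeff p M"] \<open>N \<noteq> M\<close>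
    by (simp add: linear const mult_ac del: of_nat_Suc)
  from this[of 0 1] this[of 1 1] have b2: "b 2 1 = 0" "b 2 3 = 0"
    using b22 b33 b3 N by auto
  define d where "d = Suc N"
  have "(\<Sum>k\<le>d. \<gamma> k * (b 1 3 + x * b 1 1) ^ (d - k) * b 3 3 ^ k) = c * (\<Sum>k\<le>d. \<gamma> k * x ^ (d - k))" for x
    using eq[of x 0 1] b2 b3 N
    by (simp add: g_def d_def zero_power mult.commute[of x] add.commute[of "b 1 3"] del: sum.atMost_Suc)
  then have "(\<Sum>k\<le>d. smult (\<gamma> k * b 3 3 ^ k) ([:b 1 3, b 1 1:] ^ (d - k))) = (\<Sum>k\<le>d. monom (c * \<gamma> k) (d - k))"
    by (intro poly_ext) (simp add: poly_sum poly_monom sum_distrib_left mult_ac)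
  then have coeffs: "(\<Sum>k\<le>d. \<gamma> k * b 3 3 ^ k * (of_nat ((d - k) choose m) * b 1 1 ^ m * b 1 3 ^ (d - k - m)))
     = (\<Sum>k\<le>d. if d - k = m then c * \<gamma> k else 0)" for m
    by (auto dest!: arg_cong[of _ _ "\<lambda>p. coeff p m"] simp: coeff_sum coeff_linear_power)
  have "(\<Sum>k\<le>d. \<gamma> k * b 3 3 ^ k * (of_nat ((d - k) choose d) * b 1 1 ^ d * b 1 3 ^ (d - k - d))) = (\<Sum>k\<le>d. if k = 0 then b 1 1 ^ d else 0)"
    by (intro sum.cong) (auto simp: \<gamma> binomial_eq_0)
  moreover have "(\<Sum>k\<le>d. if d - k = d then c * \<gamma> k else 0) = (\<Sum>k\<le>d. if k = 0 then c else 0)"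
    by (intro sum.cong) (auto simp: \<gamma> d_def)
  ultimately have b11: "b 1 1 ^ d = c"
    using coeffs[of d] by simp
  then have "b 1 1 \<noteq> 0"
    using c by (auto simp: d_def)
  \<comment> \<open>The coefficient of x^N: only k = 0 and k = 1 could contribute, and
    \<open>\<gamma> 1 = 0\<close>. The other side vanishes for the same reason, which forces
    \<open>b 1 3 = 0\<close>.\<close>
  have "(\<Sum>k\<le>d. \<gamma> k * b 3 3 ^ k * (of_nat ((d - k) choose N) * b 1 1 ^ N * b 1 3 ^ (d - k - N)))
      = (\<Sum>k\<le>d. if k = 0 then of_nat d * b 1 1 ^ N * b 1 3 else 0)"
  proof (intro sum.cong refl)
    fix k :: nat
    consider "k = 0" | "k = 1" | "k \<ge> 2" by linarith
    then show "\<gamma> k * b 3 3 ^ k * (of_nat ((d - k) choose N) * b 1 1 ^ N * b 1 3 ^ (d - k - N))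
      = (if k = 0 then of_nat d * b 1 1 ^ N * b 1 3 else 0)"
      using N by cases (auto simp: \<gamma>[simplified] d_def binomial_symmetric[of N "Suc N"] binomial_eq_0)
  qed
  moreover have "(\<Sum>k\<le>d. if d - k = N then c * \<gamma> k else 0) = 0"
  proof (intro sum.neutral ballI)
    fix k assume "k \<in> {..d}"
    then show "(if d - k = N then c * \<gamma> k else 0) = 0"
      using \<gamma>(2) by (cases "k = 1") (simp_all add: d_def)
  qed
  ultimately have "of_nat d * b 1 1 ^ N * b 1 3 = 0"
    using coeffs[of N] by simp
  then have b13: "b 1 3 = 0"
    using \<open>b 1 1 \<noteq> 0\<close> by (simp add: d_def del: of_nat_Suc)
  have gam: "\<gamma> k * b 1 1 ^ (d - k) * b 3 3 ^ k = c * \<gamma> k" if "k \<le> d" for k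
  proof -
    have "(\<Sum>j\<le>d. \<gamma> j * b 3 3 ^ j * (of_nat ((d - j) choose (d - k)) * b 1 1 ^ (d - k) * b 1 3 ^ (d - j - (d - k))))
      = (\<Sum>j\<le>d. if j = k then \<gamma> k * b 3 3 ^ k * b 1 1 ^ (d - k) else 0)"
    proof (intro sum.cong refl)
      fix j assume "j \<in> {..d}"
      then have "j \<le> d" by simp
      then have "d - j < d - k" if "j > k"
        using that by linarith
      moreover have "d - j - (d - k) > 0" if "j < k"
        using that \<open>k \<le> d\<close> by linarith
      ultimately show "\<gamma> j * b 3 3 ^ j * (of_nat ((d - j) choose (d - k)) * b 1 1 ^ (d - k) * b 1 3 ^ (d - j - (d - k)))
        = (if j = k then \<gamma> k * b 3 3 ^ k * b 1 1 ^ (d - k) else 0)"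
        using linorder_neqE_nat[of j k] by (cases "j = k") (auto simp: b13 binomial_eq_0 zero_power simp del: diff_diff_left)
    qed
    moreover have "(\<Sum>j\<le>d. if d - j = d - k then c * \<gamma> j else 0) = (\<Sum>j\<le>d. if j = k then c * \<gamma> k else 0)"
      using that by (intro sum.cong) auto
    ultimately show ?thesis
      using coeffs[of "d - k"] that by (simp add: mult_ac)
  qed
  \<comment> \<open>Factoring out the scalar \<open>b 1 1\<close> leaves a representative with first
    entry 1.\<close>
  define s \<eta> \<omega> where "s = b 1 1" and "\<eta> = b 2 2 / b 1 1" and "\<omega> = b 3 3 / b 1 1"
  show ?thesis
  proof
    show "s \<noteq> 0"
      using \<open>b 1 1 \<noteq> 0\<close> by (simp add: s_def)
    show "B = mat s ** diag_matrix (vector [1, \<eta>, \<omega>])"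
      using b0 b2 b3 b13 \<open>b 1 1 \<noteq> 0\<close>
      by (simp add: vec_eq_iff forall_3 matrix_matrix_mult_def sum_3 mat_def diag_matrix_def
          s_def \<eta>_def \<omega>_def b_def)
    show "\<eta> ^ N * \<omega> = 1"
      using b3 b11 c \<open>b 1 1 \<noteq> 0\<close> by (simp add: \<eta>_def \<omega>_def power_divide d_def mult.commute)
    show "\<omega> ^ k = 1" if "k \<le> Suc N" "\<gamma> k \<noteq> 0" for k
    proof -
      have "b 1 1 ^ (d - k) * b 3 3 ^ k = b 1 1 ^ (d - k) * b 1 1 ^ k"
        using gam[of k] that b11 by (simp add: d_def flip: power_add)
      then show ?thesis
        using \<open>b 1 1 \<noteq> 0\<close> by (simp add: \<omega>_def power_divide)
    qed
  qed
qed

section \<open>The automorphism group\<close>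

lemma mat_mult: "mat a ** mat b = (mat (a * b) :: 'k::comm_semiring_1 ^ 'n ^ 'n)"
  by (simp add: matrix_eq vector_smult_assoc flip: matrix_vector_mul_assoc)

lemma mat_commute: "mat a ** A = A ** mat a" for A :: "'k::field ^ 'n ^ 'n"
  by (simp add: matrix_eq vec.scale flip: matrix_vector_mul_assoc)

lemma invertible_mat: "c \<noteq> 0 \<Longrightarrow> invertible (mat c :: 'k::field ^ 'n ^ 'n)"
  unfolding invertible_def by (rule exI[of _ "mat (inverse c)"]) (simp add: mat_mult)

lemma group_GL3: "group (GL3 :: ('k::field ^ 3 ^ 3) monoid)"
proof (rule groupI)
  fix A :: "'k ^ 3 ^ 3" assume "A \<in> carrier GL3"
  then show "\<exists>B\<in>carrier GL3. B \<otimes>\<^bsub>GL3\<^esub> A = \<one>\<^bsub>GL3\<^esub>"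
    by (auto simp: GL3_def invertible_def)
qed (auto simp: GL3_def invertible_mult invertible_mat_1 matrix_mul_assoc)

lemma subgroup_scalars: "subgroup scalars (GL3 :: ('k::field ^ 3 ^ 3) monoid)"
proof (rule group.subgroupI[OF group_GL3])
  fix A :: "'k ^ 3 ^ 3" assume "A \<in> scalars"
  then obtain c where c: "A = mat c" "c \<noteq> 0"
    by (auto simp: scalars_def)
  then have "inv\<^bsub>GL3\<^esub> A = mat (inverse c)"
    by (intro group.inv_equality[OF group_GL3]) (auto simp: GL3_def mat_mult invertible_mat)
  then show "inv\<^bsub>GL3\<^esub> A \<in> scalars"
    using c by (auto simp: scalars_def)
next
  fix A B :: "'k ^ 3 ^ 3" assume "A \<in> scalars" "B \<in> scalars"
  then show "A \<otimes>\<^bsub>GL3\<^esub> B \<in> scalars"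
    by (auto simp: GL3_def scalars_def mat_mult)
qed (auto simp: GL3_def scalars_def invertible_mat intro: exI[of _ 1])

lemma normal_scalars: "normal scalars (GL3 :: ('k::field ^ 3 ^ 3) monoid)"
proof -
  interpret group "GL3 :: ('k ^ 3 ^ 3) monoid" by (rule group_GL3)
  show ?thesis
    unfolding normal_inv_iff
  proof (intro conjI ballI subgroup_scalars)
    fix A B :: "'k ^ 3 ^ 3" assume A: "A \<in> carrier GL3" and B: "B \<in> scalars"
    then have "B \<in> carrier GL3"
      using subgroup.mem_carrier[OF subgroup_scalars] by blast
    have "A \<otimes>\<^bsub>GL3\<^esub> B = B \<otimes>\<^bsub>GL3\<^esub> A"
      using B by (auto simp: GL3_def scalars_def mat_commute)
    then show "A \<otimes>\<^bsub>GL3\<^esub> B \<otimes>\<^bsub>GL3\<^esub> inv\<^bsub>GL3\<^esub> A \<in> scalars"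
      using A B \<open>B \<in> carrier GL3\<close> by (simp add: m_assoc)
  qed
qed

text \<open>The matrices whose classes form \<open>Aut F\<close>; most arguments take place here
  rather than with cosets.\<close>

definition stabilizer :: "'k::field tpoly \<Rightarrow> ('k ^ 3 ^ 3) set" where
  "stabilizer F = {A. invertible A \<and> (\<exists>c. c \<noteq> 0 \<and> lin_subst A F = tconst c * F)}"

lemma stabilizer_iff:
  fixes F :: "'k::field_char_0 tpoly"
  shows "A \<in> stabilizer F \<longleftrightarrow> invertible A \<and> (\<exists>c. c \<noteq> 0 \<and> (\<forall>v. teval F (A *v v) = c * teval F v))"
proof -
  have "lin_subst A F = tconst c * F \<longleftrightarrow> (\<forall>v. teval F (A *v v) = c * teval F v)" for c
    by (metis teval_lin_subst teval_mult teval_tconst tpoly_eqI)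
  then show ?thesis
    by (simp add: stabilizer_def)
qed

lemma subgroup_stabilizer:
  fixes F :: "'k::field_char_0 tpoly"
  shows "subgroup (stabilizer F) GL3"
proof (rule group.subgroupI[OF group_GL3])
  show "stabilizer F \<subseteq> carrier GL3"
    by (auto simp: stabilizer_def GL3_def)
  have "mat 1 \<in> stabilizer F"
    unfolding stabilizer_iff by (auto simp: invertible_mat_1 intro!: exI[of _ 1])
  then show "stabilizer F \<noteq> {}" by blast
next
  fix A assume A: "A \<in> stabilizer F"
  then obtain c where c: "c \<noteq> 0" "\<And>v. teval F (A *v v) = c * teval F v" and inv: "invertible A"
    unfolding stabilizer_iff by blast
  have mem: "A \<in> carrier GL3"
    using inv by (simp add: GL3_def)
  define B where "B = inv\<^bsub>GL3\<^esub> A"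
  have "invertible B" "A ** B = mat 1"
    using group.inv_closed[OF group_GL3 mem] group.r_inv[OF group_GL3 mem]
    by (simp_all add: GL3_def B_def)
  moreover from this have "teval F (B *v v) = inverse c * teval F v" for v
    using c(2)[of "B *v v"] c(1) by (simp add: matrix_vector_mul_assoc)
  ultimately show "inv\<^bsub>GL3\<^esub> A \<in> stabilizer F"
    unfolding stabilizer_iff B_def[symmetric] using c(1) by (auto intro!: exI[of _ "inverse c"])
next
  fix A B assume "A \<in> stabilizer F" "B \<in> stabilizer F"
  then obtain a b where "a \<noteq> 0" "\<And>v. teval F (A *v v) = a * teval F v" "invertible A"
    "b \<noteq> 0" "\<And>v. teval F (B *v v) = b * teval F v" "invertible B"
    unfolding stabilizer_iff by blast
  then show "A \<otimes>\<^bsub>GL3\<^esub> B \<in> stabilizer F"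
    unfolding stabilizer_iff by (auto simp: GL3_def invertible_mult simp flip: matrix_vector_mul_assoc intro!: exI[of _ "a * b"])
qed

lemma Aut_eq: "Aut F = PGL3\<lparr>carrier := (\<lambda>A. scalars #>\<^bsub>GL3\<^esub> A) ` stabilizer F\<rparr>"
proof -
  have "{scalars #>\<^bsub>GL3\<^esub> A | A. invertible A \<and> (\<exists>c. c \<noteq> 0 \<and> lin_subst A F = tconst c * F)}
    = (\<lambda>A. scalars #>\<^bsub>GL3\<^esub> A) ` stabilizer F"
    by (auto simp: stabilizer_def)
  then show ?thesis
    by (simp add: Aut_def)
qed

lemma carrier_Aut: "carrier (Aut F) = (\<lambda>A. scalars #>\<^bsub>GL3\<^esub> A) ` stabilizer F"
  by (simp add: Aut_eq)

text \<open>The image of the subgroup \<open>stabilizer F\<close> under the projection from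
  \<open>GL3\<close> to \<open>PGL3\<close>.\<close>

lemma group_Aut:
  fixes F :: "'k::field_char_0 tpoly"
  shows "group (Aut F)"
proof -
  interpret normal scalars "GL3 :: ('k ^ 3 ^ 3) monoid" by (rule normal_scalars)
  interpret P: group "PGL3 :: ('k ^ 3 ^ 3) set monoid"
    unfolding PGL3_def by (rule factorgroup_is_group)
  interpret h: group_hom "GL3 :: ('k ^ 3 ^ 3) monoid" PGL3 "\<lambda>A. scalars #>\<^bsub>GL3\<^esub> A"
    by (intro group_hom.intro group_hom_axioms.intro group_GL3 P.is_group)
      (use r_coset_hom_Mod in \<open>simp add: PGL3_def\<close>)
  show ?thesis
    unfolding Aut_eq by (intro subgroup.subgroup_is_group h.subgroup_img_is_subgroup subgroup_stabilizer P.is_group)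
qed

lemma Aut_pow:
  fixes F :: "'k::field_char_0 tpoly"
  assumes "invertible A"
  shows "(scalars #>\<^bsub>GL3\<^esub> A) [^]\<^bsub>Aut F\<^esub> (n::nat) = scalars #>\<^bsub>GL3\<^esub> matrix_power A n"
proof -
  interpret normal scalars "GL3 :: ('k ^ 3 ^ 3) monoid" by (rule normal_scalars)
  note inv = invertible_matrix_power[OF assms]
  show ?thesis
  proof (induction n)
    case 0
    have "scalars #>\<^bsub>GL3\<^esub> \<one>\<^bsub>GL3\<^esub> = (scalars :: ('k ^ 3 ^ 3) set)"
      by (intro coset_mult_one subset)
    then show ?case
      by (simp add: Aut_def PGL3_def GL3_def)
  next
    case (Suc n)
    have "(scalars #>\<^bsub>GL3\<^esub> matrix_power A n) <#>\<^bsub>GL3\<^esub> (scalars #>\<^bsub>GL3\<^esub> A)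
      = scalars #>\<^bsub>GL3\<^esub> (matrix_power A n \<otimes>\<^bsub>GL3\<^esub> A)"
      by (intro rcos_sum) (simp_all add: GL3_def inv assms)
    then have "(scalars #>\<^bsub>GL3\<^esub> matrix_power A n) \<otimes>\<^bsub>Aut F\<^esub> (scalars #>\<^bsub>GL3\<^esub> A)
      = scalars #>\<^bsub>GL3\<^esub> matrix_power A (Suc n)"
      by (simp add: Aut_def PGL3_def) (simp add: GL3_def)
    then show ?case
      by (simp add: Suc)
  qed
qed

lemma coset_scalars_eq_iff:
  assumes "invertible (A :: 'k::field ^ 3 ^ 3)"
  shows "scalars #>\<^bsub>GL3\<^esub> A = scalars \<longleftrightarrow> (\<exists>c. A = mat c)"
proof -
  interpret group "GL3 :: ('k ^ 3 ^ 3) monoid" by (rule group_GL3)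
  have A: "A \<in> carrier GL3"
    using assms by (simp add: GL3_def)
  have "c \<noteq> 0" if "A = mat c" for c
    using that assms invertible_matD by blast
  then have "A \<in> scalars \<longleftrightarrow> (\<exists>c. A = mat c)"
    by (auto simp: scalars_def)
  then show ?thesis
    using coset_join1[OF _ A subgroup_scalars] coset_join2[OF A subgroup_scalars] by blast
qed

lemma coset_scalars_mat_mult:
  assumes "c \<noteq> 0" "invertible (A :: 'k::field ^ 3 ^ 3)"
  shows "scalars #>\<^bsub>GL3\<^esub> (mat c ** A) = scalars #>\<^bsub>GL3\<^esub> A"
proof -
  interpret group "GL3 :: ('k ^ 3 ^ 3) monoid" by (rule group_GL3)
  have "scalars #>\<^bsub>GL3\<^esub> (mat c \<otimes>\<^bsub>GL3\<^esub> A) = (scalars #>\<^bsub>GL3\<^esub> mat c) #>\<^bsub>GL3\<^esub> A"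
    using assms by (intro coset_mult_assoc[symmetric] subgroup.subset[OF subgroup_scalars])
      (simp_all add: GL3_def invertible_mat)
  also have "scalars #>\<^bsub>GL3\<^esub> mat c = scalars"
    using assms by (subst coset_scalars_eq_iff) (auto simp: invertible_mat)
  finally show ?thesis
    by (simp add: GL3_def)
qed

text \<open>Reduces cyclicity to matrices: one stabilizing matrix whose powers exhaust the
  stabilizer up to scalars.\<close>

lemma cyclic_AutI:
  fixes F :: "'k::field_char_0 tpoly"
  assumes A: "A \<in> stabilizer F"
    and gen: "\<And>B. B \<in> stabilizer F \<Longrightarrow> \<exists>c n. c \<noteq> 0 \<and> B = mat c ** matrix_power A n"
  shows "cyclic_group (Aut F)"
proof -
  interpret group "Aut F" by (rule group_Aut)
  have inv: "invertible A"
    using A by (simp add: stabilizer_def)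
  note inv_pow = invertible_matrix_power[OF inv]
  define x where "x = scalars #>\<^bsub>GL3\<^esub> A"
  have x: "x \<in> carrier (Aut F)"
    using A by (simp add: x_def carrier_Aut)
  have "carrier (Aut F) \<subseteq> range (\<lambda>n::int. x [^]\<^bsub>Aut F\<^esub> n)"
  proof
    fix y assume "y \<in> carrier (Aut F)"
    then obtain B where B: "B \<in> stabilizer F" "y = scalars #>\<^bsub>GL3\<^esub> B"
      by (auto simp: carrier_Aut)
    then obtain c n where "c \<noteq> 0" "B = mat c ** matrix_power A n"
      using gen by blast
    then have "y = x [^]\<^bsub>Aut F\<^esub> n"
      using B by (simp add: coset_scalars_mat_mult inv_pow x_def Aut_pow inv)
    then show "y \<in> range (\<lambda>n::int. x [^]\<^bsub>Aut F\<^esub> n)"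
      by (metis int_pow_int rangeI)
  qed
  then have "carrier (Aut F) = range (\<lambda>n::int. x [^]\<^bsub>Aut F\<^esub> n)"
    using x by auto
  then show ?thesis
    unfolding cyclic_group using x by blast
qed

text \<open>The trivial class consists of the scalar matrices, so the order of a class becomes the
  condition on matrix powers required by \<open>normal_form_of_ord\<close>.\<close>

lemma ord_Aut:
  fixes F :: "'k::field_char_0 tpoly"
  assumes "A \<in> stabilizer F"
  shows "(\<exists>s. matrix_power A n = mat s) \<longleftrightarrow> group.ord (Aut F) (scalars #>\<^bsub>GL3\<^esub> A) dvd n"
proof -
  interpret group "Aut F" by (rule group_Aut)
  have inv: "invertible A"
    using assms by (simp add: stabilizer_def)
  note inv_pow = invertible_matrix_power[OF inv]
  have "(\<exists>s. matrix_power A n = mat s) \<longleftrightarrow> (scalars #>\<^bsub>GL3\<^esub> A) [^]\<^bsub>Aut F\<^esub> n = \<one>\<^bsub>Aut F\<^esub>"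
    using coset_scalars_eq_iff[OF inv_pow] by (simp add: Aut_pow inv) (auto simp: Aut_def PGL3_def)
  also have "\<dots> \<longleftrightarrow> group.ord (Aut F) (scalars #>\<^bsub>GL3\<^esub> A) dvd n"
    using assms by (intro pow_eq_id) (simp add: carrier_Aut)
  finally show ?thesis .
qed

section \<open>Cyclicity of the automorphism group of the normal form\<close>

definition normal_form_coeff :: "nat \<Rightarrow> nat \<Rightarrow> 'k \<Rightarrow> (nat \<Rightarrow> 'k) \<Rightarrow> nat \<Rightarrow> 'k::comm_ring_1" where
  "normal_form_coeff d l \<alpha> \<beta> k = (if k = 0 then 1 else if k = d - 1 then \<alpha>
    else if 2 \<le> k \<and> k \<le> d - 2 \<and> l dvd k then \<beta> k else 0)"

lemma teval_normal_form_galois_form: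
  assumes d: "d \<ge> 5"
  shows "teval (normal_form d l \<alpha> \<beta>) v = galois_form (d - 1) (normal_form_coeff d l \<alpha> \<beta>) v"
proof -
  define \<gamma> where "\<gamma> = normal_form_coeff d l \<alpha> \<beta>"
  note \<gamma> = \<gamma>_def normal_form_coeff_def
  define R where "R = {k. 2 \<le> k \<and> k \<le> d - 2 \<and> l dvd k}"
  have sub: "insert 0 (insert (d - 1) R) \<subseteq> {..d}"
    using d by (auto simp: R_def)
  then have fin: "finite R"
    by (meson finite_atMost finite_insert finite_subset)
  have notin: "d - 1 \<notin> R" "0 \<notin> insert (d - 1) R" and d': "d - (d - 1) = 1" "Suc (d - 1) = d"
    using d by (auto simp: R_def)
  have "(\<Sum>k\<le>d. \<gamma> k * v $ 1 ^ (d - k) * v $ 3 ^ k)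
    = (\<Sum>k\<in>insert 0 (insert (d - 1) R). \<gamma> k * v $ 1 ^ (d - k) * v $ 3 ^ k)"
    by (rule sum.mono_neutral_right[OF _ sub]) (auto simp: \<gamma> R_def)
  also have "\<dots> = \<gamma> 0 * v $ 1 ^ d + (\<gamma> (d - 1) * v $ 1 * v $ 3 ^ (d - 1) + (\<Sum>k\<in>R. \<gamma> k * v $ 1 ^ (d - k) * v $ 3 ^ k))"
    using fin notin by (simp add: d'(1))
  also have "(\<Sum>k\<in>R. \<gamma> k * v $ 1 ^ (d - k) * v $ 3 ^ k) = (\<Sum>k\<in>R. \<beta> k * v $ 1 ^ (d - k) * v $ 3 ^ k)"
    using d by (intro sum.cong) (auto simp: \<gamma> R_def)
  also have "\<gamma> 0 = 1"
    using d by (auto simp: \<gamma>)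
  also have "\<gamma> (d - 1) = \<alpha>"
    using d by (auto simp: \<gamma>)
  finally show ?thesis
    unfolding teval_normal_form galois_form_def d'(2) by (simp add: R_def \<gamma>_def)
qed

lemma matrix_power_conj:
  fixes T :: "'k::semiring_1 ^ 'n ^ 'n"
  assumes "T' ** T = mat 1" "T ** T' = mat 1"
  shows "matrix_power (T ** D ** T') n = T ** matrix_power D n ** T'"
proof (induction n)
  case (Suc n)
  have "matrix_power (T ** D ** T') (Suc n) = T ** matrix_power D n ** (T' ** T) ** D ** T'"
    by (simp add: Suc matrix_mul_assoc)
  then show ?case
    by (simp add: assms matrix_mul_assoc)
qed (simp add: assms)

lemma matrix_power_diag_matrix:
  "matrix_power (diag_matrix (vector [1, x, y] :: 'k::field ^ 3)) n = diag_matrix (vector [1, x ^ n, y ^ n])"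
proof (induction n)
  case (Suc n)
  have "diag_matrix (vector [1, x ^ n, y ^ n] :: 'k ^ 3) ** diag_matrix (vector [1, x, y])
    = diag_matrix (vector [1, x ^ Suc n, y ^ Suc n])"
    by (simp add: matrix_eq vec_eq_iff forall_3 mult_ac flip: matrix_vector_mul_assoc)
  then show ?case
    by (simp add: Suc)
qed (simp add: matrix_eq vec_eq_iff forall_3)

text \<open>For a primitive root \<zeta> of order N^2, it determines which powers \<zeta>^i satisfy
  (\<zeta>^i)^(N k) = 1 for all k in S: those with i a multiple of N / gcd S.\<close>

lemma exponent_dvd_iff_Gcd:
  fixes N :: nat
  assumes "N \<in> S" "N > 0"
  shows "(\<forall>k\<in>S. N * N dvd i * (N * k)) \<longleftrightarrow> N div Gcd S dvd i"
proof -
  have G: "Gcd S dvd N" "Gcd S > 0"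
    using assms by (auto intro!: Nat.gr0I)
  have "(\<forall>k\<in>S. N * N dvd i * (N * k)) \<longleftrightarrow> (\<forall>k\<in>S. N dvd i * k)"
    using assms by (simp add: mult.left_commute[of i])
  also have "\<dots> \<longleftrightarrow> N dvd Gcd ((*) i ` S)"
    by (simp add: dvd_Gcd_iff)
  also have "Gcd ((*) i ` S) = i * Gcd S"
    by (simp add: Gcd_mult)
  also have "N dvd i * Gcd S \<longleftrightarrow> N div Gcd S dvd i"
    using G by (metis dvd_div_mult_self nat_mult_dvd_cancel_disj mult.commute neq0_conv)
  finally show ?thesis .
qed

text \<open>Up to scalars and conjugation, automorphisms are diag(1, \<eta>, \<eta>^(-N)) with
  \<eta>^(N k) = 1 for each k in S. These \<eta> form a subgroup of the N^2-th roots of unity,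
  generated by x.\<close>

lemma cyclic_Aut_normal_form:
  fixes F :: "'k::{alg_closed_field, field_char_0} tpoly"
  assumes d: "d \<ge> 5" and T: "invertible T" and \<alpha>: "\<alpha> \<noteq> 0"
    and F: "lin_subst T F = normal_form d l \<alpha> \<beta>"
  shows "cyclic_group (Aut F)"
proof -
  define N where "N = d - 1"
  have N: "N \<ge> 4" "Suc N = d"
    using d by (simp_all add: N_def)
  define \<gamma> where "\<gamma> = normal_form_coeff d l \<alpha> \<beta>"
  define f where "f = galois_form N \<gamma>"
  have FT: "teval F (T *v v) = f v" for v
    using teval_normal_form_galois_form[OF d, of l \<alpha> \<beta> v] arg_cong[OF F, of "\<lambda>F. teval F v"]
    unfolding f_def N_def \<gamma>_def by simp
  obtain T' where T': "T' ** T = mat 1" "T ** T' = mat 1"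
    using T unfolding invertible_def by blast
  then have "invertible T'"
    unfolding invertible_def by blast
  have cancel: "T *v (T' *v v) = v" "T' *v (T *v v) = v" for v
    by (simp_all add: matrix_vector_mul_assoc T')
  have FT': "teval F v = f (T' *v v)" for v
    using FT[of "T' *v v"] by (simp add: cancel)
  \<comment> \<open>The exponents of Z that occur in the part in X and Z. It contains N because
    \<alpha> is nonzero, which later bounds the order of \<eta> by N^2.\<close>
  define S where "S = {k. k \<le> Suc N \<and> \<gamma> k \<noteq> 0}"
  have S: "N \<in> S"
    using N \<alpha> by (simp add: S_def \<gamma>_def normal_form_coeff_def N_def)
  obtain \<zeta> :: 'k where \<zeta>: "\<And>k. \<zeta> ^ k = 1 \<longleftrightarrow> N * N dvd k"
    using ex_primitive_root_of_unity[of "N * N"] N by auto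
  have "\<zeta> \<noteq> 0"
    using \<zeta>[of "N * N"] N by (auto simp: zero_power)
  define x where "x = \<zeta> ^ (N div Gcd S)"
  define y where "y = inverse (x ^ N)"
  have "x \<noteq> 0" using \<open>\<zeta> \<noteq> 0\<close> by (simp add: x_def)
  have roots: "(\<forall>k\<in>S. (\<zeta> ^ i) ^ (N * k) = 1) \<longleftrightarrow> N div Gcd S dvd i" for i
    using exponent_dvd_iff_Gcd[OF S, of i] N by (simp add: \<zeta> flip: power_mult)
  define D :: "'k ^ 3 ^ 3" where "D = diag_matrix (vector [1, x, y])"
  have fD: "f (D *v v) = f v" for v
  proof -
    have "y ^ k = 1" if "k \<in> S" for k
      using roots[of "N div Gcd S"] that by (simp add: y_def x_def power_inverse mult.assoc flip: power_mult)
    then have "\<gamma> k * v $ 1 ^ (Suc N - k) * (y * v $ 3) ^ k = \<gamma> k * v $ 1 ^ (Suc N - k) * v $ 3 ^ k"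
      if "k \<le> Suc N" for k
      using that by (cases "\<gamma> k = 0") (simp_all add: S_def power_mult_distrib)
    then have "(\<Sum>k\<le>Suc N. \<gamma> k * v $ 1 ^ (Suc N - k) * (y * v $ 3) ^ k)
        = (\<Sum>k\<le>Suc N. \<gamma> k * v $ 1 ^ (Suc N - k) * v $ 3 ^ k)"
      by (intro sum.cong) simp_all
    moreover have "(x * v $ 2) ^ N * (y * v $ 3) = v $ 2 ^ N * v $ 3"
      using \<open>x \<noteq> 0\<close> by (simp add: power_mult_distrib y_def)
    ultimately show ?thesis
      by (simp add: f_def galois_form_def D_def del: sum.atMost_Suc)
  qed
  have "v = 0" if "D *v v = 0" for v
    using that \<open>x \<noteq> 0\<close> by (simp add: D_def vec_eq_iff forall_3 y_def)
  then have "invertible D"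
    using matrix_left_invertible_ker[of D] invertible_left_inverse[of D] by blast
  show ?thesis
  proof (rule cyclic_AutI)
    show "T ** D ** T' \<in> stabilizer F"
      unfolding stabilizer_iff
      using T \<open>invertible D\<close> \<open>invertible T'\<close>
      by (auto simp: invertible_mult FT' cancel fD simp flip: matrix_vector_mul_assoc intro!: exI[of _ 1])
  next
    fix B assume "B \<in> stabilizer F"
    then obtain c where c: "c \<noteq> 0" "\<And>v. teval F (B *v v) = c * teval F v" and B: "invertible B"
      unfolding stabilizer_iff by blast
    define C where "C = T' ** B ** T"
    have "invertible C"
      unfolding C_def using B T \<open>invertible T'\<close> by (intro invertible_mult)
    moreover have "galois_form N \<gamma> (C *v v) = c * galois_form N \<gamma> v" for v
    proof -
      have "f (C *v v) = teval F (B *v (T *v v))"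
        by (simp add: FT' C_def matrix_vector_mul_assoc matrix_mul_assoc)
      then show ?thesis
        by (simp add: c FT f_def)
    qed
    \<comment> \<open>The sum starts at j = 2 and d - 1 > 1, so X^(d-1) Z is missing.\<close>
    moreover have "\<gamma> 0 = 1" "\<gamma> 1 = 0"
      using d by (simp_all add: \<gamma>_def normal_form_coeff_def)
    ultimately obtain s \<eta> \<omega> where s: "s \<noteq> 0" "C = mat s ** diag_matrix (vector [1, \<eta>, \<omega>])"
      and \<eta>: "\<eta> ^ N * \<omega> = 1" and \<omega>: "\<And>k. k \<le> Suc N \<Longrightarrow> \<gamma> k \<noteq> 0 \<Longrightarrow> \<omega> ^ k = 1"
      using galois_form_automorphism[of N \<gamma> C c] N c by metis
    have \<eta>_pow: "\<eta> ^ (N * k) = 1" if "k \<in> S" for k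
    proof -
      have "(\<eta> ^ N * \<omega>) ^ k = 1"
        using \<eta> by simp
      then show ?thesis
        using \<omega>[of k] that by (simp add: S_def power_mult_distrib power_mult)
    qed
    have "\<eta> ^ (N * N) = 1"
      using \<eta>_pow S by blast
    then obtain i where i: "\<eta> = \<zeta> ^ i"
      using roots_of_unity_primitive_powers[of "N * N" \<zeta>] \<zeta> N by auto
    have "N div Gcd S dvd i"
      using roots[of i] \<eta>_pow by (simp add: i)
    then obtain j where "i = N div Gcd S * j"
      by blast
    then have x: "\<eta> = x ^ j"
      by (simp add: i x_def power_mult)
    moreover have "\<omega> = y ^ j"
    proof -
      have "\<omega> = inverse (\<eta> ^ N)"
        using \<eta> by (metis inverse_unique)
      then show ?thesis
        by (simp add: x y_def power_inverse power_commute)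
    qed
    ultimately have "C = mat s ** matrix_power D j"
      using s by (simp add: D_def matrix_power_diag_matrix)
    \<comment> \<open>Conjugating back to the original coordinates; the scalar commutes with
      everything, so B is a scalar times a power of the chosen generator.\<close>
    moreover have "B = T ** C ** T'"
    proof -
      have "T ** C ** T' = (T ** T') ** B ** (T ** T')"
        by (simp only: C_def matrix_mul_assoc)
      then show ?thesis by (simp add: T')
    qed
    ultimately have "B = T ** mat s ** matrix_power D j ** T'"
      by (simp add: matrix_mul_assoc)
    also have "\<dots> = mat s ** matrix_power (T ** D ** T') j"
      by (simp add: matrix_power_conj[OF T'] matrix_mul_assoc flip: mat_commute)
    finally show "\<exists>c n. c \<noteq> 0 \<and> B = mat c ** matrix_power (T ** D ** T') n"
      using s by blast
  qed
qed

theorem proposition50: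
  fixes F :: "'k::{alg_closed_field, field_char_0} tpoly" and d l :: nat
  assumes "d \<ge> 5" and "2 \<le> l" and "l \<le> d - 1" and "[d = 1] (mod l)"
    and "nonsingular_plane_curve d F"
    and "\<exists>g\<in>carrier (Aut F). group.ord (Aut F) g = l * (d - 1)"
  shows "(\<exists>(\<alpha>::'k) (\<beta>::nat \<Rightarrow> 'k). \<alpha> \<noteq> 0 \<and>
            isomorphic_curves F
              (tvar 1 ^ d + tvar 2 ^ (d - 1) * tvar 3 + tconst \<alpha> * tvar 1 * tvar 3 ^ (d - 1)
               + (\<Sum>j | 2 \<le> j \<and> j \<le> d - 2 \<and> l dvd j.
                    tconst (\<beta> j) * tvar 1 ^ (d - j) * tvar 3 ^ j)))
         \<and> cyclic_group (Aut F)"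
proof -
  obtain A where A: "A \<in> stabilizer F" "group.ord (Aut F) (scalars #>\<^bsub>GL3\<^esub> A) = l * (d - 1)"
    using assms(6) unfolding carrier_Aut by blast
  have "l dvd d - 1"
    using assms(1,4) by (simp add: cong_altdef_nat)
  moreover obtain c where "invertible A" "c \<noteq> 0" "lin_subst A F = tconst c * F"
    using A(1) unfolding stabilizer_def by blast
  ultimately obtain T \<alpha> \<beta> where T: "invertible T" "\<alpha> \<noteq> 0" "lin_subst T F = normal_form d l \<alpha> \<beta>"
    using normal_form_of_ord[of d l F A c] ord_Aut[OF A(1)] A(2) assms by metis
  then have "lin_subst T F = tconst 1 * normal_form d l \<alpha> \<beta>"
    by (simp add: tconst_def)
  then have "isomorphic_curves F (normal_form d l \<alpha> \<beta>)"
    unfolding isomorphic_curves_def using T(1) zero_neq_one by metis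
  moreover have "cyclic_group (Aut F)"
    using cyclic_Aut_normal_form[OF assms(1) T] .
  ultimately show ?thesis
    using T(2) unfolding normal_form_def by blast
qed

end
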